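(* Let $P$ and $P'$ be two cyclic $n$-gons ($n\ge 3$), either both in the Euclidean plane or both in the hyperbolic plane, whose side lengths, listed in cyclic order, are equal. Then $P$ and $P'$ are congruent, i.e. there is an isometry of the plane carrying $P$ to $P'$ and matching the corresponding sides.
   Context: Polygons are non-degenerate simple polygons. A Euclidean polygon is cyclic if it can be inscribed in a Euclidean circle, i.e. all its vertices lie on one circle. A hyperbolic polygon is cyclic if it can be inscribed in a hyperbolic circle, or a hypercycle, or a horocycle, i.e. all its vertices lie on a single such curve; a hypercycle is one connected component of the set of points at a fixed positive distance from a geodesic. *)

theory Defs
  imports "HOL-Analysis.Analysis"
begin

section \<open>The hyperbolic plane\<close>

text \<open>The upper half-plane model, with the distance induced by the Riemannian metric
  \<open>(dx\<^sup>2 + dy\<^sup>2) / y\<^sup>2\<close> of curvature \<open>-1\<close>.\<close>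

typedef hyp_plane = "{z :: complex. Im z > 0}"
  morphisms hp_coord hp_point
  by (rule exI[of _ \<i>]) simp

lemma Im_hp_coord_pos: "Im (hp_coord p) > 0"
  using hp_coord[of p] by simp

definition hyp_cosh_dist :: "complex \<Rightarrow> complex \<Rightarrow> real" where
  "hyp_cosh_dist z w = 1 + (cmod (z - w))\<^sup>2 / (2 * Im z * Im w)"

lemma hyp_cosh_dist_ge_1: "Im z > 0 \<Longrightarrow> Im w > 0 \<Longrightarrow> hyp_cosh_dist z w \<ge> 1"
  by (simp add: hyp_cosh_dist_def)

lemma hyp_cosh_dist_commute: "hyp_cosh_dist z w = hyp_cosh_dist w z"
  by (simp add: hyp_cosh_dist_def norm_minus_commute mult.commute mult.left_commute)

lemma hyp_cosh_dist_gram: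
  assumes "Im u > 0" "Im v > 0" "Im w > 0"
  defines "A \<equiv> hyp_cosh_dist u w" and "B \<equiv> hyp_cosh_dist w v" and "C \<equiv> hyp_cosh_dist u v"
  shows "(C - A * B)\<^sup>2 \<le> (A\<^sup>2 - 1) * (B\<^sup>2 - 1)"
proof -
  obtain a b where u: "u = Complex a b" by (cases u)
  obtain c d where v: "v = Complex c d" by (cases v)
  obtain e f where w: "w = Complex e f" by (cases w)
  have pos: "b > 0" "d > 0" "f > 0" using assms(1-3) by (auto simp: u v w)
  have AB: "A = ((a-e)\<^sup>2 + b\<^sup>2 + f\<^sup>2) / (2*b*f)" "B = ((e-c)\<^sup>2 + d\<^sup>2 + f\<^sup>2) / (2*f*d)"
    "C = ((a-c)\<^sup>2 + b\<^sup>2 + d\<^sup>2) / (2*b*d)"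
    using pos unfolding A_def B_def C_def hyp_cosh_dist_def cmod_power2 u v w
    by (simp_all add: field_simps power2_eq_square)
  define D where
    "D = (c - e) * (a\<^sup>2 + b\<^sup>2) + (e - a) * (c\<^sup>2 + d\<^sup>2) + (a - c) * (e\<^sup>2 + f\<^sup>2)"
  have "(A\<^sup>2 - 1) * (B\<^sup>2 - 1) - (C - A * B)\<^sup>2 = (D / (2*b*d*f))\<^sup>2"
    unfolding AB D_def using pos
    by (simp add: divide_simps) algebra
  then show ?thesis
    by (metis diff_ge_0_iff_ge zero_le_power2)
qed

instantiation hyp_plane :: metric_space
begin

definition dist_hyp_plane :: "hyp_plane \<Rightarrow> hyp_plane \<Rightarrow> real" where
  "dist p q = arcosh (hyp_cosh_dist (hp_coord p) (hp_coord q))"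

definition uniformity_hyp_plane_def:
  "(uniformity :: (hyp_plane \<times> hyp_plane) filter) =
     (INF e\<in>{0<..}. principal {(p, q). dist p q < e})"

definition open_hyp_plane_def:
  "open (U :: hyp_plane set) \<longleftrightarrow> (\<forall>p\<in>U. \<forall>\<^sub>F (p', q) in uniformity. p' = p \<longrightarrow> q \<in> U)"

instance
proof
  fix p q s :: hyp_plane
  note pos = Im_hp_coord_pos
  show "dist p q = 0 \<longleftrightarrow> p = q"
  proof -
    have "dist p q = 0 \<longleftrightarrow> hyp_cosh_dist (hp_coord p) (hp_coord q) = 1"
      unfolding dist_hyp_plane_def by (intro arcosh_eq_0_iff_real hyp_cosh_dist_ge_1 pos)
    also have "\<dots> \<longleftrightarrow> p = q"
      using pos[of p] pos[of q] by (simp add: hyp_cosh_dist_def hp_coord_inject)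
    finally show ?thesis .
  qed
  define A where "A = hyp_cosh_dist (hp_coord p) (hp_coord s)"
  define B where "B = hyp_cosh_dist (hp_coord s) (hp_coord q)"
  define C where "C = hyp_cosh_dist (hp_coord p) (hp_coord q)"
  have ge: "A \<ge> 1" "B \<ge> 1" "C \<ge> 1"
    unfolding A_def B_def C_def by (intro hyp_cosh_dist_ge_1 pos)+
  have "(C - A * B)\<^sup>2 \<le> (A\<^sup>2 - 1) * (B\<^sup>2 - 1)"
    unfolding A_def B_def C_def by (intro hyp_cosh_dist_gram pos)
  then have "C - A * B \<le> sqrt ((A\<^sup>2 - 1) * (B\<^sup>2 - 1))"
    by (rule real_le_rsqrt)
  also have "\<dots> = sinh (arcosh A) * sinh (arcosh B)"
    using ge by (simp add: sinh_arcosh_real real_sqrt_mult)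
  finally have "C \<le> cosh (arcosh A + arcosh B)"
    using ge by (simp add: cosh_add)
  then have "arcosh C \<le> arcosh (cosh (arcosh A + arcosh B))"
    using ge arcosh_less_iff_real[of "cosh (arcosh A + arcosh B)" C] by linarith
  also have "\<dots> = arcosh A + arcosh B"
    using ge by (intro arcosh_cosh_real add_nonneg_nonneg) auto
  finally have "dist p q \<le> dist p s + dist s q"
    by (simp add: dist_hyp_plane_def A_def B_def C_def)
  then show "dist p q \<le> dist p s + dist q s"
    by (simp add: dist_hyp_plane_def hyp_cosh_dist_commute)
qed (rule uniformity_hyp_plane_def open_hyp_plane_def)+

end

definition hyp_geodesic :: "hyp_plane set \<Rightarrow> bool" where
  "hyp_geodesic L \<longleftrightarrow>
     (\<exists>\<gamma> :: real \<Rightarrow> hyp_plane. (\<forall>s t. dist (\<gamma> s) (\<gamma> t) = \<bar>s - t\<bar>) \<and> L = range \<gamma>)"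

definition hyp_circle :: "hyp_plane set \<Rightarrow> bool" where
  "hyp_circle K \<longleftrightarrow> (\<exists>c r. r > 0 \<and> K = sphere c r)"

definition hypercycle :: "hyp_plane set \<Rightarrow> bool" where
  "hypercycle K \<longleftrightarrow>
     (\<exists>L r. hyp_geodesic L \<and> r > 0 \<and> K \<in> components {p. infdist p L = r})"

text \<open>A horocycle is a horizontal Euclidean line (centred at the ideal point \<open>\<infinity>\<close>) or a
  Euclidean circle tangent to the real axis at an ideal point \<open>a\<close>, which itself is not a point of
  the plane.\<close>

definition horocycle :: "hyp_plane set \<Rightarrow> bool" where
  "horocycle K \<longleftrightarrow>
     (\<exists>h > 0. K = {p. Im (hp_coord p) = h}) \<or>
     (\<exists>a r. r > 0 \<and> K = {p. dist (hp_coord p) (Complex a r) = r})"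


section \<open>Polygons\<close>

text \<open>The geodesic segment as a metric interval: \<^term>\<open>closed_segment p q\<close> in a Euclidean
  space.\<close>

definition geo_segment :: "'a :: metric_space \<Rightarrow> 'a \<Rightarrow> 'a set" where
  "geo_segment p q = {x. dist p x + dist x q = dist p q}"

lemma geo_segment_eq_closed_segment:
  "geo_segment p q = closed_segment p (q :: 'a :: euclidean_space)"
  by (auto simp: geo_segment_def between_mem_segment [symmetric] between)

text \<open>A polygon is given by the list \<open>P\<close> of its vertices in cyclic order; side \<open>i\<close> joins vertex \<open>i\<close>
  to vertex \<open>i + 1\<close> modulo the number of vertices.\<close>

definition next_vertex :: "'a list \<Rightarrow> nat \<Rightarrow> 'a" where
  "next_vertex P i = P ! (Suc i mod length P)"

definition side :: "'a :: metric_space list \<Rightarrow> nat \<Rightarrow> 'a set" where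
  "side P i = geo_segment (P ! i) (next_vertex P i)"

definition side_length :: "'a :: metric_space list \<Rightarrow> nat \<Rightarrow> real" where
  "side_length P i = dist (P ! i) (next_vertex P i)"

definition polygon_curve :: "'a :: metric_space list \<Rightarrow> 'a set" where
  "polygon_curve P = (\<Union>i<length P. side P i)"

text \<open>Simple: distinct sides meet only in common endpoints. Non-degenerate: the vertices are
  pairwise distinct and no interior angle is straight.\<close>

definition simple_polygon :: "'a :: metric_space list \<Rightarrow> bool" where
  "simple_polygon P \<longleftrightarrow>
     length P \<ge> 3 \<and> distinct P \<and>
     (\<forall>i<length P. \<forall>j<length P. i \<noteq> j \<longrightarrow>
        side P i \<inter> side P j = {P ! i, next_vertex P i} \<inter> {P ! j, next_vertex P j}) \<and>
     (\<forall>i<length P. next_vertex P i \<notin> geo_segment (P ! i) (next_vertex P (Suc i mod length P)))"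

definition euclidean_cyclic :: "(real ^ 2) list \<Rightarrow> bool" where
  "euclidean_cyclic P \<longleftrightarrow> (\<exists>c r. r > 0 \<and> set P \<subseteq> sphere c r)"

definition hyperbolic_cyclic :: "hyp_plane list \<Rightarrow> bool" where
  "hyperbolic_cyclic P \<longleftrightarrow>
     (\<exists>K. (hyp_circle K \<or> hypercycle K \<or> horocycle K) \<and> set P \<subseteq> K)"

definition plane_isometry :: "('a :: metric_space \<Rightarrow> 'a) \<Rightarrow> bool" where
  "plane_isometry f \<longleftrightarrow> bij f \<and> (\<forall>x y. dist (f x) (f y) = dist x y)"

definition congruent_polygons :: "'a :: metric_space list \<Rightarrow> 'a list \<Rightarrow> bool" where
  "congruent_polygons P P' \<longleftrightarrow> length P = length P' \<and>
     (\<exists>f. plane_isometry f \<and> f ` polygon_curve P = polygon_curve P' \<and>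
          (\<forall>i<length P. f ` side P i = side P' i))"

end

theory Submission
  imports Defs
begin

text \<open>
  Lengths enter through the half chord \<open>s\<close> of two points: half the distance in the Euclidean plane, and
  \<open>sinh (dist p q / 2)\<close> in the hyperbolic plane, which is half the Lorentzian length of the chord in the hyperboloid
  model. There circles, horocycles and hypercycles are ellipses, parabolas and branches of hyperbolas in
  affine planes. They have a parameter \<open>t\<close> in which the half chord is \<open>R * \<bar>sin (t p - t q)\<bar>\<close>, \<open>\<bar>t p - t q\<bar>\<close> or
  \<open>c * sinh \<bar>t p - t q\<bar>\<close>, respectively; the first formula also holds for Euclidean circles
  (\<open>euclidean_circle_chart\<close>, \<open>hyp_circle_chart\<close>, \<open>horocycle_chart\<close>, \<open>hypercycle_chart\<close>).

  Points on such a curve are in convex position, so two chords with interleaved endpoints intersect. Hence the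
  vertices of a simple inscribed polygon follow each other monotonically along the curve, except for one side
  that leads back (\<open>inscribed_polygon_monotone\<close>). On a circle the gaps of the parameter along the sides therefore sum to
  \<open>\<pi>\<close>; on the other curves one gap is the sum of all others.

  On positive arguments the sine is strictly subadditive up to \<open>\<pi>\<close>, the identity is additive, and the hyperbolic sine is
  strictly superadditive.
  So every side is shorter than the sum of the others for a circle, while for a horocycle one side equals
  this sum and for a hypercycle one side exceeds it, all measured by \<open>s\<close>. Therefore the sides show the
  type of the curve. They also determine the radius: if the chords of given lengths are transferred to a larger circle, the
  gaps change by \<open>x \<mapsto> arcsin (k * sin x)\<close> with \<open>k < 1\<close>, up to passing to the supplement, and this function is strictly
  subadditive, so that the condition on the sum of the gaps is violated (\<open>circle_radius_not_less\<close>). The same reasoning with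
  \<open>x \<mapsto> arsinh (k * sinh x)\<close> applies to hypercycles (\<open>hypercycle_width_not_less\<close>). With the radius the gaps are
  determined, and thus all distances between vertices (\<open>chords_determined_by_sides\<close>).

  Finally, the isometry that carries three vertices of the first polygon to the corresponding vertices of the second one
  carries every vertex to the corresponding vertex (\<open>congruent_polygons_if_dist_eq\<close>).
\<close>

section \<open>Subadditivity and the rigidity of angles\<close>

text \<open>Strict superadditivity is the same statement for \<open>- f\<close>; for functions on the whole half-line the bound \<open>b\<close>
can be any number above the sum.\<close>

lemma strict_subadditive_sum:
  fixes f \<alpha> :: "_ \<Rightarrow> real"
  assumes sub: "\<And>x y. 0 < x \<Longrightarrow> 0 < y \<Longrightarrow> x + y < b \<Longrightarrow> f (x + y) < f x + f y"
    and S: "finite S" "2 \<le> card S" and pos: "\<And>i. i \<in> S \<Longrightarrow> 0 < \<alpha> i" and b: "sum \<alpha> S < b"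
  shows "f (sum \<alpha> S) < (\<Sum>i\<in>S. f (\<alpha> i))"
proof -
  have "S \<noteq> {}" using S by auto
  from S(1) this pos b
  have "f (sum \<alpha> S) \<le> (\<Sum>i\<in>S. f (\<alpha> i)) \<and> (2 \<le> card S \<longrightarrow> f (sum \<alpha> S) < (\<Sum>i\<in>S. f (\<alpha> i)))"
  proof (induction S rule: finite_ne_induct)
    case (insert i S)
    have p: "0 < \<alpha> i" "0 < sum \<alpha> S"
      using insert by (auto intro!: sum_pos)
    have "f (\<alpha> i + sum \<alpha> S) < f (\<alpha> i) + f (sum \<alpha> S)"
      using insert p by (intro sub) auto
    moreover have "sum \<alpha> S < b" using insert.prems(2) insert.hyps p by simp
    then have "f (sum \<alpha> S) \<le> (\<Sum>i\<in>S. f (\<alpha> i))"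
      using insert.IH insert.prems(1) by simp
    ultimately show ?case using insert.hyps by simp
  qed auto
  then show ?thesis using S by blast
qed

lemma sum_remove_lessThan:
  fixes \<alpha> :: "nat \<Rightarrow> real"
  shows "j < n \<Longrightarrow> sum \<alpha> {..<n} = \<alpha> j + sum \<alpha> ({..<n} - {j})"
  by (simp add: sum.remove)

lemma angle_less_pi:
  assumes "3 \<le> (n::nat)" and pos: "\<And>i. i < n \<Longrightarrow> 0 < \<alpha> i" and "sum \<alpha> {..<n} = pi" "j < n"
  shows "\<alpha> j < pi"
proof -
  have "card ({..<n} - {j}) = n - 1" using assms by simp
  then have "{..<n} - {j} \<noteq> {}" using \<open>3 \<le> n\<close> by (intro notI) simp
  then have "0 < sum \<alpha> ({..<n} - {j})" using pos by (intro sum_pos) auto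
  then show ?thesis using sum_remove_lessThan[OF assms(4), of \<alpha>] assms(3) by linarith
qed

text \<open>The function \<open>x \<mapsto> arcsin (t sin x)\<close> converts the half-angle under which a chord is seen from the centre
of a circle into the half-angle of an equally long chord in a circle larger by the factor \<open>1 / t\<close>.
With \<open>A\<close> and \<open>B\<close> the images of \<open>x\<close> and \<open>y\<close>, the addition theorem gives the claim, since
\<open>cos A > cos x\<close> and \<open>cos B > cos y\<close>.\<close>

lemma arcsin_scaled_sin_subadditive:
  assumes t: "0 < t" "t < 1" and xy: "0 < x" "0 < y" "x + y < pi"
  shows "arcsin (t * sin (x + y)) < arcsin (t * sin x) + arcsin (t * sin y)"
proof -
  have s: "0 < sin x" "0 < sin y" "0 < sin (x + y)" "sin x \<le> 1" "sin y \<le> 1"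
    using xy by (auto intro: sin_gt_zero)
  have lt1: "t * sin z < 1" if "0 < sin z" for z
  proof -
    have "t * sin z \<le> t * 1" using t by (intro mult_left_mono) auto
    then show ?thesis using t by linarith
  qed
  have b: "0 < t * sin z" if "0 < sin z" for z using that t by simp
  define A B where "A = arcsin (t * sin x)" and "B = arcsin (t * sin y)"
  have sA: "sin A = t * sin x" "sin B = t * sin y"
    unfolding A_def B_def using lt1[OF s(1)] lt1[OF s(2)] b[OF s(1)] b[OF s(2)] by simp_all
  have AB: "0 < A" "A < pi/2" "0 < B" "B < pi/2"
    unfolding A_def B_def
    using arcsin_lt_bounded[of "t * sin x"] arcsin_lt_bounded[of "t * sin y"]
      arcsin_less_arcsin[of 0 "t * sin x"] arcsin_less_arcsin[of 0 "t * sin y"]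
      lt1[OF s(1)] lt1[OF s(2)] b[OF s(1)] b[OF s(2)] by auto
  have cos_gt: "cos z < cos Z" if "sin Z = t * sin z" "0 < sin z" "0 < Z" "Z < pi/2" for z Z
  proof -
    have "t\<^sup>2 * (sin z)\<^sup>2 < 1 * (sin z)\<^sup>2"
      using that t by (intro mult_strict_right_mono) (auto simp: power_less_one_iff)
    then have "(cos z)\<^sup>2 < (cos Z)\<^sup>2"
      using that(1) by (simp add: cos_squared_eq power_mult_distrib)
    moreover have "0 < cos Z" using that by (intro cos_gt_zero) auto
    ultimately show ?thesis using power2_less_imp_less[of "cos z" "cos Z"] by simp
  qed
  show ?thesis
  proof (cases "A + B < pi/2")
    case True
    have "t * sin (x + y) = (t * sin x) * cos y + (t * sin y) * cos x"
      by (simp add: sin_add algebra_simps)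
    also have "\<dots> < (t * sin x) * cos B + (t * sin y) * cos A"
      using cos_gt[OF sA(1) s(1) AB(1,2)] cos_gt[OF sA(2) s(2) AB(3,4)] b[OF s(1)] b[OF s(2)]
      by (intro add_strict_mono mult_strict_left_mono) auto
    also have "\<dots> = sin (A + B)" by (simp add: sin_add sA)
    finally have "t * sin (x + y) < sin (A + B)" .
    then have "arcsin (t * sin (x + y)) < arcsin (sin (A + B))"
      using b[OF s(3)] by (intro arcsin_less_arcsin) auto
    then show ?thesis using True AB unfolding A_def B_def by (simp add: arcsin_sin)
  next
    case False
    then show ?thesis using arcsin_lt_bounded[of "t * sin (x + y)"] lt1[OF s(3)] b[OF s(3)]
      unfolding A_def B_def by auto
  qed
qed

text \<open>In the larger circle at most one half-angle can exceed a right angle. If none does, all half-angles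
are smaller than those in the smaller circle, so the sums cannot both be \<open>\<pi>\<close>. If the \<open>j\<close>-th one does, its
supplement is the sum of the other ones; but the supplement is the image under \<open>g\<close> of
the sum of the other half-angles in the smaller circle, whereas the other half-angles themselves are the
single images, and \<open>g\<close> is strictly subadditive.\<close>

lemma circle_radius_not_less:
  fixes n :: nat
  assumes n: "3 \<le> n"
    and pos: "\<And>i. i < n \<Longrightarrow> 0 < \<alpha> i" "\<And>i. i < n \<Longrightarrow> 0 < \<alpha>' i"
    and sums: "sum \<alpha> {..<n} = pi" "sum \<alpha>' {..<n} = pi"
    and R: "0 < R" "0 < R'" and chords: "\<And>i. i < n \<Longrightarrow> R * sin (\<alpha> i) = R' * sin (\<alpha>' i)"
  shows "\<not> R < R'"
proof
  assume less: "R < R'"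
  define t where "t = R / R'"
  have t: "0 < t" "t < 1" using R less by (auto simp: t_def)
  define g where "g x = arcsin (t * sin x)" for x
  have s: "sin (\<alpha>' i) = t * sin (\<alpha> i)" if "i < n" for i
    using chords[OF that] R by (simp add: t_def field_simps)
  have lt: "\<alpha> i < pi" "\<alpha>' i < pi" if "i < n" for i
    using angle_less_pi[of n \<alpha>, OF n pos(1) sums(1) that] angle_less_pi[of n \<alpha>', OF n pos(2) sums(2) that]
    by auto
  have g: "g (\<alpha> i) = \<alpha>' i" if "i < n" "\<alpha>' i \<le> pi/2" for i
    using that pos(2)[OF that(1)] by (simp add: g_def s[symmetric] arcsin_sin)
  show False
  proof (cases "\<exists>j<n. \<alpha>' j > pi/2")
    case True
    then obtain j where j: "j < n" "\<alpha>' j > pi/2" by blast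
    let ?S = "{..<n} - {j}"
    have tot: "\<alpha> j + sum \<alpha> ?S = pi" "\<alpha>' j + sum \<alpha>' ?S = pi"
      using sum_remove_lessThan[OF j(1)] sums by metis+
    have "\<alpha>' i \<le> pi/2" if "i \<in> ?S" for i
    proof -
      have "\<alpha>' i \<le> sum \<alpha>' ?S" using that pos by (intro member_le_sum) (auto intro: less_imp_le)
      then show ?thesis using tot j by linarith
    qed
    then have "(\<Sum>i\<in>?S. g (\<alpha> i)) = sum \<alpha>' ?S" by (intro sum.cong) (auto intro: g)
    moreover have "g (sum \<alpha> ?S) < (\<Sum>i\<in>?S. g (\<alpha> i))"
    proof (rule strict_subadditive_sum)
      show "sum \<alpha> ?S < pi" using tot pos(1)[OF j(1)] by linarith
      show "2 \<le> card ?S" using n j by simp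
    qed (use pos t in \<open>auto simp: g_def intro: arcsin_scaled_sin_subadditive\<close>)
    moreover have "g (sum \<alpha> ?S) = pi - \<alpha>' j"
    proof -
      have "sum \<alpha> ?S = pi - \<alpha> j" using tot by linarith
      then have "g (sum \<alpha> ?S) = arcsin (sin (pi - \<alpha>' j))"
        by (simp add: g_def s[OF j(1)])
      also have "\<dots> = pi - \<alpha>' j" using j lt(2)[OF j(1)] by (intro arcsin_sin) auto
      finally show ?thesis .
    qed
    ultimately show False using tot by linarith
  next
    case False
    have "\<alpha>' i < \<alpha> i" if "i < n" for i
    proof (rule ccontr)
      assume "\<not> \<alpha>' i < \<alpha> i"
      then have "sin (\<alpha> i) \<le> sin (\<alpha>' i)"
        using False that pos(1)[OF that] by (intro sin_monotone_2pi_le) auto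
      moreover have "t * sin (\<alpha> i) < 1 * sin (\<alpha> i)"
        using t pos(1)[OF that] lt(1)[OF that] by (intro mult_strict_right_mono sin_gt_zero) auto
      ultimately show False using s[OF that] by linarith
    qed
    then have "sum \<alpha>' {..<n} < sum \<alpha> {..<n}" using n by (intro sum_strict_mono) (auto simp: lessThan_empty_iff)
    then show False using sums by simp
  qed
qed

text \<open>Once the radii agree, corresponding half-angles are equal or supplementary. Over the set \<open>M\<close> of indices where
they differ both families have the same sum, hence each has sum \<open>card M * \<pi> / 2\<close>. A single index would give two right
angles, which do not differ. Otherwise the sum is at least \<open>\<pi>\<close>, which forces \<open>card M = 2\<close> and
leaves nothing for a third index.\<close>

lemma circle_angles_unique:
  fixes n :: nat
  assumes n: "3 \<le> n"
    and pos: "\<And>i. i < n \<Longrightarrow> 0 < \<alpha> i" "\<And>i. i < n \<Longrightarrow> 0 < \<alpha>' i"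
    and sums: "sum \<alpha> {..<n} = pi" "sum \<alpha>' {..<n} = pi"
    and R: "0 < R" "0 < R'" and chords: "\<And>i. i < n \<Longrightarrow> R * sin (\<alpha> i) = R' * sin (\<alpha>' i)"
  shows "R = R' \<and> (\<forall>i<n. \<alpha> i = \<alpha>' i)"
proof -
  have RR: "R = R'"
    using circle_radius_not_less[OF n pos sums R chords]
      circle_radius_not_less[OF n pos(2,1) sums(2,1) R(2,1) chords[symmetric]] by linarith
  define M where "M = {i. i < n \<and> \<alpha> i \<noteq> \<alpha>' i}"
  have M: "finite M" "M \<subseteq> {..<n}" by (auto simp: M_def)
  have lt: "\<alpha> i < pi" "\<alpha>' i < pi" if "i < n" for i
    using angle_less_pi[of n \<alpha>, OF n pos(1) sums(1) that] angle_less_pi[of n \<alpha>', OF n pos(2) sums(2) that]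
    by auto
  have suppl: "\<alpha> i + \<alpha>' i = pi" if "i \<in> M" for i
  proof -
    have i: "i < n" "\<alpha> i \<noteq> \<alpha>' i" using that by (auto simp: M_def)
    have "sin (\<alpha> i) = sin (\<alpha>' i)" using chords[OF i(1)] RR R by simp
    then have "sin ((\<alpha> i - \<alpha>' i) / 2) * cos ((\<alpha> i + \<alpha>' i) / 2) = 0"
      using sin_diff_sin[of "\<alpha> i" "\<alpha>' i"] by simp
    moreover have "sin ((\<alpha> i - \<alpha>' i) / 2) \<noteq> 0"
    proof -
      have "sin \<bar>(\<alpha> i - \<alpha>' i) / 2\<bar> > 0"
        using i lt(1)[OF i(1)] lt(2)[OF i(1)] pos(1)[OF i(1)] pos(2)[OF i(1)]
        by (intro sin_gt_zero) (auto simp: abs_if field_simps)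
      then show ?thesis by (auto simp: abs_if split: if_splits)
    qed
    ultimately have *: "cos ((\<alpha> i + \<alpha>' i) / 2) = cos (pi/2)"
      unfolding cos_pi_half mult_eq_0_iff by (elim disjE) (rule notE)
    have "0 \<le> (\<alpha> i + \<alpha>' i) / 2" "(\<alpha> i + \<alpha>' i) / 2 \<le> pi" "0 \<le> pi/2" "pi/2 \<le> pi"
      using lt(1)[OF i(1)] lt(2)[OF i(1)] pos(1)[OF i(1)] pos(2)[OF i(1)] pi_gt_zero by auto
    from cos_inj_pi[OF this *] have "(\<alpha> i + \<alpha>' i) / 2 = pi/2" .
    then show ?thesis by simp
  qed
  have split: "sum f {..<n} = sum f M + sum f ({..<n} - M)" for f :: "nat \<Rightarrow> real"
    using sum.subset_diff[OF M(2), of f] by simp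
  have "sum \<alpha> ({..<n} - M) = sum \<alpha>' ({..<n} - M)" by (intro sum.cong) (auto simp: M_def)
  then have "sum \<alpha> M = sum \<alpha>' M" using split[of \<alpha>] split[of \<alpha>'] sums by linarith
  moreover have "sum \<alpha> M + sum \<alpha>' M = card M * pi"
    using suppl by (simp add: sum.distrib[symmetric])
  ultimately have half: "sum \<alpha> M = card M * pi / 2" by simp
  have "M = {}"
  proof (rule ccontr)
    assume "M \<noteq> {}"
    then have "card M > 0" using M by (simp add: card_gt_0_iff)
    then consider "card M = 1" | "card M = 2" | "card M \<ge> 3" by linarith
    then show False
    proof cases
      case 1
      then obtain j where j: "M = {j}" by (meson card_1_singletonE)
      then have "\<alpha> j = pi/2" using half by simp
      then show False using suppl[of j] j by (auto simp: M_def)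
    next
      case 2
      then have "M \<noteq> {..<n}" using n by auto
      then have "0 < sum \<alpha> ({..<n} - M)" using M pos by (intro sum_pos) auto
      then show False using split[of \<alpha>] half 2 sums by simp
    next
      case 3
      have "0 \<le> sum \<alpha> ({..<n} - M)" using pos by (intro sum_nonneg) (auto intro: less_imp_le)
      then have "card M * pi / 2 \<le> pi" using split[of \<alpha>] half sums by linarith
      moreover have "3 * pi \<le> card M * pi" using 3 by (intro mult_right_mono) auto
      ultimately show False using pi_gt_zero by linarith
    qed
  qed
  then show ?thesis using RR by (auto simp: M_def)
qed

text \<open>The hyperbolic counterpart of \<open>arcsin_scaled_sin_subadditive\<close>; the inequality is reversed because now
\<open>cosh A < cosh x\<close>.\<close>

lemma arsinh_scaled_sinh_superadditive:
  assumes t: "0 < t" "t < 1" and xy: "0 < x" "0 < (y::real)"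
  shows "arsinh (t * sinh x) + arsinh (t * sinh y) < arsinh (t * sinh (x + y))"
proof -
  define A B where "A = arsinh (t * sinh x)" and "B = arsinh (t * sinh y)"
  have sA: "sinh A = t * sinh x" "sinh B = t * sinh y" by (simp_all add: A_def B_def)
  have b: "0 < t * sinh x" "0 < t * sinh y" using t xy by auto
  have cosh_lt: "cosh Z < cosh z" if "sinh Z = t * sinh z" "0 < sinh z" for z Z :: real
  proof -
    have "t\<^sup>2 * (sinh z)\<^sup>2 < 1 * (sinh z)\<^sup>2"
      using that t by (intro mult_strict_right_mono) (auto simp: power_less_one_iff)
    then have "(cosh Z)\<^sup>2 < (cosh z)\<^sup>2"
      using that(1) by (simp add: cosh_square_eq power_mult_distrib)
    then show ?thesis by (meson power2_less_imp_less cosh_real_nonneg)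
  qed
  have "sinh (A + B) = (t * sinh x) * cosh B + (t * sinh y) * cosh A" by (simp add: sinh_add sA)
  also have "\<dots> < (t * sinh x) * cosh y + (t * sinh y) * cosh x"
    using cosh_lt[OF sA(1)] cosh_lt[OF sA(2)] b xy
    by (intro add_strict_mono mult_strict_left_mono) auto
  also have "\<dots> = t * sinh (x + y)" by (simp add: sinh_add algebra_simps)
  also have "\<dots> = sinh (arsinh (t * sinh (x + y)))" by simp
  finally show ?thesis unfolding A_def B_def by (simp only: sinh_real_less_iff)
qed

text \<open>The index \<open>j\<close> stands for the side that closes up the chain of the sides in \<open>S\<close>: along a hypercycle its
gap is the sum of theirs. Passing from the factor \<open>c\<close> to a larger one turns the gaps \<open>\<alpha>\<close> into the values of
a strictly superadditive function, so this relation would not survive.\<close>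

lemma hypercycle_width_not_less:
  assumes S: "finite S" "2 \<le> card S"
    and pos: "\<And>i. i \<in> S \<Longrightarrow> 0 < \<alpha> i"
    and sums: "\<alpha> j = sum \<alpha> S" "\<alpha>' j = sum \<alpha>' S"
    and c: "0 < c" "0 < c'" and chords: "\<And>i. i \<in> insert j S \<Longrightarrow> c * sinh (\<alpha> i) = c' * sinh (\<alpha>' i :: real)"
  shows "\<not> c < c'"
proof
  assume less: "c < c'"
  define t where "t = c / c'"
  have t: "0 < t" "t < 1" using c less by (auto simp: t_def)
  define g where "g x = - arsinh (t * sinh x)" for x :: real
  have g: "g (\<alpha> i) = - \<alpha>' i" if "i \<in> insert j S" for i
  proof -
    have "t * sinh (\<alpha> i) = sinh (\<alpha>' i)" using chords[OF that] c by (simp add: t_def field_simps)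
    then show ?thesis by (simp add: g_def arsinh_sinh_real)
  qed
  have "g (sum \<alpha> S) < (\<Sum>i\<in>S. g (\<alpha> i))"
  proof (rule strict_subadditive_sum[where b = "sum \<alpha> S + 1"])
    show "g (x + y) < g x + g y" if "0 < x" "0 < y" for x y
      using arsinh_scaled_sinh_superadditive[OF t that] by (simp add: g_def)
  qed (use S pos in auto)
  moreover have "(\<Sum>i\<in>S. g (\<alpha> i)) = - sum \<alpha>' S" using g by (simp add: sum_negf)
  ultimately show False using g[of j] sums by simp
qed

section \<open>Non-crossing paths on a line\<close>

definition strictly_between :: "real \<Rightarrow> real \<Rightarrow> real \<Rightarrow> bool" where
  "strictly_between a b x \<longleftrightarrow> min a b < x \<and> x < max a b"

text \<open>A closed polygonal chain whose segments do not cross is considered as a path \<open>w 0, \<dots>, w (m - 1)\<close> on the line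
that is closed up through an extra vertex at infinity; \<open>first\<close> and \<open>last\<close> say that the two segments through
infinity are not crossed. If the path steps back for the first time from \<open>w i\<close>, it must step into the gap
between \<open>w (i - 1)\<close> and \<open>w i\<close>, as any larger step would cross an earlier segment. It is then trapped in this
gap, so its end lies there, contradicting \<open>last\<close>.\<close>

lemma noncrossing_path_increasing:
  fixes w :: "nat \<Rightarrow> real"
  assumes inj: "inj_on w {..<m}"
    and path: "\<And>i j. Suc i < m \<Longrightarrow> Suc j < m \<Longrightarrow> Suc i < j \<or> Suc j < i \<Longrightarrow>
      strictly_between (w i) (w (Suc i)) (w j) \<longleftrightarrow> strictly_between (w i) (w (Suc i)) (w (Suc j))"
    and first: "\<And>i. Suc i < m \<Longrightarrow> 0 < i \<Longrightarrow> \<not> strictly_between (w i) (w (Suc i)) (w 0)"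
    and last: "\<And>i. Suc (Suc i) < m \<Longrightarrow> \<not> strictly_between (w i) (w (Suc i)) (w (m - 1))"
    and start: "w 0 < w 1"
  shows "Suc i < m \<Longrightarrow> w i < w (Suc i)"
proof (induction i rule: less_induct)
  case (less i)
  show ?case
  proof (rule ccontr)
    assume "\<not> w i < w (Suc i)"
    moreover have "w i \<noteq> w (Suc i)" using inj_onD[OF inj, of i "Suc i"] less.prems by auto
    ultimately have drop: "w (Suc i) < w i" by simp
    then have i: "0 < i" using start by (cases i) auto
    have inc: "w k < w (Suc k)" if "k < i" for k using less that by auto
    have le: "w k \<le> w i" if "k \<le> i" for k
      using that by (induction rule: inc_induct) (use inc in force)+
    have lower: "w k < w (Suc i)" if "k < i" for k
      using that
    proof (induction k)
      case 0
      then show ?case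
      proof -
        have "w 0 \<noteq> w (Suc i)" using inj_onD[OF inj, of 0 "Suc i"] less.prems by auto
        then show ?thesis using first[of i] less.prems i drop inc[of 0] le[of 1]
          by (auto simp: strictly_between_def)
      qed
    next
      case (Suc k)
      then have a: "w k < w (Suc i)" "Suc k < i" by auto
      have "\<not> strictly_between (w k) (w (Suc k)) (w i)"
        using le[of "Suc k"] inc[of k] a by (auto simp: strictly_between_def)
      then have "\<not> strictly_between (w k) (w (Suc k)) (w (Suc i))"
        using path[of k i] a less.prems by auto
      moreover have "w (Suc k) \<noteq> w (Suc i)"
        using inj_onD[OF inj, of "Suc k" "Suc i"] a less.prems by auto
      ultimately show ?case using a inc[of k] by (simp add: strictly_between_def min_def max_def)
    qed
    obtain k where k: "i = Suc k" using i by (cases i) auto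
    have "strictly_between (w k) (w i) (w j)" if "Suc i \<le> j" "j < m" for j
      using that
    proof (induction j rule: dec_induct)
      case base
      then show ?case using lower[of k] drop k inc[of k] by (auto simp: strictly_between_def)
    next
      case (step j)
      then show ?case using path[of k j] k by auto
    qed
    from this[of "m - 1"] show False using last[of k] less.prems k by auto
  qed
qed

text \<open>The hypotheses with the point at infinity are invariant under reflection of the line, so that a first step
downwards is covered as well.\<close>

lemma noncrossing_path_monotone:
  fixes w :: "nat \<Rightarrow> real"
  assumes inj: "inj_on w {..<m}" and m: "2 \<le> m"
    and path: "\<And>i j. Suc i < m \<Longrightarrow> Suc j < m \<Longrightarrow> Suc i < j \<or> Suc j < i \<Longrightarrow>
      strictly_between (w i) (w (Suc i)) (w j) \<longleftrightarrow> strictly_between (w i) (w (Suc i)) (w (Suc j))"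
    and first: "\<And>i. Suc i < m \<Longrightarrow> 0 < i \<Longrightarrow> \<not> strictly_between (w i) (w (Suc i)) (w 0)"
    and last: "\<And>i. Suc (Suc i) < m \<Longrightarrow> \<not> strictly_between (w i) (w (Suc i)) (w (m - 1))"
  shows "(\<forall>i. Suc i < m \<longrightarrow> w i < w (Suc i)) \<or> (\<forall>i. Suc i < m \<longrightarrow> w (Suc i) < w i)"
proof -
  have "w 0 \<noteq> w 1" using inj_onD[OF inj, of 0 1] m by auto
  then consider "w 0 < w 1" | "- w 0 < - w 1" by linarith
  then show ?thesis
  proof cases
    case 1
    then show ?thesis using noncrossing_path_increasing[OF inj path first last] by blast
  next
    case 2
    have neg: "strictly_between (- a) (- b) (- x) \<longleftrightarrow> strictly_between a b x" for a b x
      by (auto simp: strictly_between_def)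
    have "Suc i < m \<Longrightarrow> - w i < - w (Suc i)" for i
      by (rule noncrossing_path_increasing[where w = "\<lambda>i. - w i" and m = m])
         (use inj path first last 2 in \<open>auto simp: neg inj_on_def\<close>)
    then show ?thesis by simp
  qed
qed

section \<open>Inscribed polygons in an oriented plane\<close>

lemma geo_segment_commute: "geo_segment p q = geo_segment q p"
  by (auto simp: geo_segment_def dist_commute add.commute)

lemma isometry_image_geo_segment:
  assumes "plane_isometry f"
  shows "f ` geo_segment p q = geo_segment (f p) (f q)"
proof -
  have d: "dist (f x) (f y) = dist x y" for x y using assms by (simp add: plane_isometry_def)
  have "y \<in> f ` geo_segment p q" if "y \<in> geo_segment (f p) (f q)" for y
  proof -
    obtain x where "y = f x" using assms by (metis plane_isometry_def bij_pointE)
    then show ?thesis using that d by (auto simp: geo_segment_def)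
  qed
  then show ?thesis using d by (auto simp: geo_segment_def)
qed

lemma mod_shift_inj:
  assumes "(k + a) mod n = (k + b) mod n" "a < n" "b < (n::nat)"
  shows "a = b"
  using assms
proof (induction a b rule: linorder_wlog)
  case (le a b)
  then have "n dvd (k + b) - (k + a)" by (metis mod_eq_dvd_iff_nat add_le_mono order_refl)
  then show ?case using le by (auto dest: dvd_imp_le)
qed simp

lemma mod_shift_surj:
  assumes "i < n" "k < (n::nat)"
  obtains a where "a < n" "i = (k + a) mod n"
proof (cases "k \<le> i")
  case True
  then show ?thesis using assms that[of "i - k"] by simp
next
  case False
  then show ?thesis using assms that[of "i + n - k"] by simp
qed

text \<open>The properties of the two planes on which the argument depends. In both of them \<open>orient a b c\<close> is the
  determinant of three vectors in \<open>\<real>\<^sup>3\<close> that represent the points; it is nonzero for triangles.\<close>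

locale oriented_plane =
  fixes orient :: "'a::metric_space \<Rightarrow> 'a \<Rightarrow> 'a \<Rightarrow> real"
  assumes orient_swap12: "orient b a c = - orient a b c"
    and orient_swap23: "orient a c b = - orient a b c"
    and diagonals_meet: "0 < orient a b c \<Longrightarrow> 0 < orient a b d \<Longrightarrow> 0 < orient a c d \<Longrightarrow>
      0 < orient b c d \<Longrightarrow> geo_segment a c \<inter> geo_segment b d \<noteq> {}"
    and three_distances: "orient a b c \<noteq> 0 \<Longrightarrow>
      dist x a = dist y a \<Longrightarrow> dist x b = dist y b \<Longrightarrow> dist x c = dist y c \<Longrightarrow> x = y"
    and three_point_extension: "orient a b c \<noteq> 0 \<Longrightarrow>
      dist a' (b' :: 'a) = dist a b \<Longrightarrow> dist a' c' = dist a c \<Longrightarrow> dist b' c' = dist b c \<Longrightarrow>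
      \<exists>f. f a = a' \<and> f b = b' \<and> f c = c' \<and> (\<forall>x y. dist (f x) (f y) = dist x y)"
begin

text \<open>An injective parameter along a curve for which all triangles with increasing parameters have the same
  orientation, that is, the points of the curve are in convex position in the order of the parameter.
  The factor \<open>\<sigma>\<close> leaves the sense of rotation open.\<close>

definition convex_chart :: "'a set \<Rightarrow> ('a \<Rightarrow> real) \<Rightarrow> bool" where
  "convex_chart K t \<longleftrightarrow> inj_on t K \<and>
     (\<exists>\<sigma>. \<forall>a\<in>K. \<forall>b\<in>K. \<forall>c\<in>K. t a < t b \<longrightarrow> t b < t c \<longrightarrow> 0 < \<sigma> * orient a b c)"

lemma convex_chart_orient_nonzero:
  assumes "convex_chart K t" "a \<in> K" "b \<in> K" "c \<in> K" "a \<noteq> b" "a \<noteq> c" "b \<noteq> c"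
  shows "orient a b c \<noteq> 0"
proof -
  obtain \<sigma> where \<sigma>: "\<And>a b c. a \<in> K \<Longrightarrow> b \<in> K \<Longrightarrow> c \<in> K \<Longrightarrow> t a < t b \<Longrightarrow> t b < t c \<Longrightarrow>
      0 < \<sigma> * orient a b c" and inj: "inj_on t K"
    using assms(1) unfolding convex_chart_def by blast
  have ne: "t a \<noteq> t b" "t a \<noteq> t c" "t b \<noteq> t c"
    using inj assms(2-) by (auto dest: inj_onD)
  have perms: "orient a c b = - orient a b c" "orient b a c = - orient a b c"
    "orient b c a = orient a b c" "orient c a b = orient a b c" "orient c b a = - orient a b c"
    using orient_swap12 orient_swap23 by (metis minus_minus)+
  show ?thesis
    using \<sigma>[of a b c] \<sigma>[of a c b] \<sigma>[of b a c] \<sigma>[of b c a] \<sigma>[of c a b] \<sigma>[of c b a] assms(2-4) ne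
    by (auto simp: perms) linarith
qed

lemma convex_chart_diagonals_meet:
  assumes "convex_chart K t" "a \<in> K" "b \<in> K" "c \<in> K" "d \<in> K" "t a < t b" "t b < t c" "t c < t d"
  shows "geo_segment a c \<inter> geo_segment b d \<noteq> {}"
proof -
  obtain \<sigma> where \<sigma>: "\<And>a b c. a \<in> K \<Longrightarrow> b \<in> K \<Longrightarrow> c \<in> K \<Longrightarrow> t a < t b \<Longrightarrow> t b < t c \<Longrightarrow>
      0 < \<sigma> * orient a b c"
    using assms(1) unfolding convex_chart_def by blast
  have pos: "0 < \<sigma> * orient a b c" "0 < \<sigma> * orient a b d" "0 < \<sigma> * orient a c d" "0 < \<sigma> * orient b c d"
    using assms by (auto intro!: \<sigma>)
  have flip: "orient z y x = - orient x y z" for x y z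
    using orient_swap12 orient_swap23 by (metis minus_minus)
  show ?thesis
  proof (cases "0 < \<sigma>")
    case True
    then show ?thesis using pos by (intro diagonals_meet) (auto simp: zero_less_mult_iff)
  next
    case False
    then have "geo_segment d b \<inter> geo_segment c a \<noteq> {}"
      using pos by (intro diagonals_meet) (auto simp: zero_less_mult_iff flip[of d] flip[of c])
    then show ?thesis by (simp add: geo_segment_commute Int_commute)
  qed
qed

lemma convex_chart_interleaved_chords_meet:
  assumes chart: "convex_chart K t" and K: "a \<in> K" "b \<in> K" "c \<in> K" "d \<in> K"
    and "strictly_between (t a) (t b) (t c)" "\<not> strictly_between (t a) (t b) (t d)" "d \<noteq> a" "d \<noteq> b"
  shows "geo_segment a b \<inter> geo_segment c d \<noteq> {}"
proof -
  have inj: "inj_on t K" using chart by (simp add: convex_chart_def)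
  have *: "geo_segment p q \<inter> geo_segment c d \<noteq> {}"
    if "p \<in> K" "q \<in> K" "t p < t c" "t c < t q" "t d < t p \<or> t q < t d" for p q
    using that convex_chart_diagonals_meet[OF chart, of d p c q]
      convex_chart_diagonals_meet[OF chart, of p c q d] K
    by (auto simp: Int_commute geo_segment_commute[of c d])
  have "t d \<noteq> t a" "t d \<noteq> t b" using inj assms by (auto dest: inj_onD)
  then show ?thesis
    using *[of a b] *[of b a] assms
    by (auto simp: strictly_between_def geo_segment_commute[of b a] min_def max_def split: if_splits)
qed

text \<open>Sides of a simple polygon do not meet unless they are adjacent, so their endpoints do not interleave on
the curve. The vertex \<open>k\<close> with the least parameter serves as the vertex at infinity of
\<open>noncrossing_path_monotone\<close>; \<open>w\<close> runs through the other vertices. The exceptional side \<open>J\<close> is the one that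
returns from the last vertex in the order of the curve to the first one.\<close>

lemma inscribed_polygon_monotone:
  assumes simple: "simple_polygon P" and chart: "convex_chart K t" and K: "set P \<subseteq> K"
  shows "\<exists>J<length P. \<exists>\<sigma>\<in>{1, -1}. \<forall>i<length P. i \<noteq> J \<longrightarrow> \<sigma> * t (P ! i) < \<sigma> * t (next_vertex P i)"
proof -
  define n where "n = length P"
  have n: "3 \<le> n" and dist: "distinct P" using simple by (auto simp: simple_polygon_def n_def)
  have mod_less: "i mod n < n" for i using n by (intro mod_less_divisor) linarith
  define p where "p i = P ! (i mod n)" for i
  define x where "x i = t (p i)" for i
  have pK: "p i \<in> K" for i
  proof -
    have "i mod n < length P" using mod_less by (simp add: n_def)
    then show ?thesis using K nth_mem unfolding p_def by blast
  qed
  have p_eq: "p i = p j \<longleftrightarrow> i mod n = j mod n" for i j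
    using dist mod_less nth_eq_iff_index_eq[of P "i mod n" "j mod n"] by (simp add: p_def n_def)
  have x_eq: "x i = x j \<longleftrightarrow> i mod n = j mod n" for i j
    using chart pK p_eq by (metis x_def convex_chart_def inj_onD)
  have x_mod: "x (i mod n) = x i" for i by (simp add: x_eq)
  have next_x: "t (next_vertex P i) = x (Suc i)" for i
    by (simp add: next_vertex_def x_def p_def n_def)
  have noncross: "strictly_between (x i) (x (Suc i)) (x j) \<longleftrightarrow> strictly_between (x i) (x (Suc i)) (x (Suc j))"
    if disj: "{i mod n, Suc i mod n} \<inter> {j mod n, Suc j mod n} = {}" for i j
  proof -
    have side: "side P (i mod n) = geo_segment (p i) (p (Suc i))" for i
      by (simp add: side_def next_vertex_def p_def n_def mod_Suc_eq)
    have "side P (i mod n) \<inter> side P (j mod n) =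
      {P ! (i mod n), next_vertex P (i mod n)} \<inter> {P ! (j mod n), next_vertex P (j mod n)}"
      using simple mod_less[of i] mod_less[of j] disj unfolding simple_polygon_def n_def[symmetric]
      by (metis (no_types, lifting) disjoint_iff insertI1)
    also have "\<dots> = {p i, p (Suc i)} \<inter> {p j, p (Suc j)}"
      by (simp add: next_vertex_def p_def n_def mod_Suc_eq)
    also have "\<dots> = {}" using disj by (auto simp: p_eq)
    finally have empty: "geo_segment (p i) (p (Suc i)) \<inter> geo_segment (p j) (p (Suc j)) = {}"
      by (simp add: side)
    have ne: "p j \<noteq> p i" "p j \<noteq> p (Suc i)" "p (Suc j) \<noteq> p i" "p (Suc j) \<noteq> p (Suc i)"
      using disj by (auto simp: p_eq)
    show ?thesis
      using convex_chart_interleaved_chords_meet[OF chart pK[of i] pK[of "Suc i"] pK[of j] pK[of "Suc j"]]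
        convex_chart_interleaved_chords_meet[OF chart pK[of i] pK[of "Suc i"] pK[of "Suc j"] pK[of j]]
        empty ne geo_segment_commute[of "p j" "p (Suc j)"]
      unfolding x_def by metis
  qed
  have "finite (x ` {..<n})" "x ` {..<n} \<noteq> {}" using n by (auto simp: lessThan_empty_iff)
  then have "Min (x ` {..<n}) \<in> x ` {..<n}" by (rule Min_in)
  then obtain k where k: "k < n" "x k = Min (x ` {..<n})" by auto
  have "x k \<le> x i" for i
  proof -
    have "x k \<le> x (i mod n)" using k n by auto
    then show ?thesis by (simp add: x_mod)
  qed
  then have min: "x k < x i" if "i mod n \<noteq> k mod n" for i
    using that x_eq by (metis order_le_imp_less_or_eq)
  have shift: "(k + a) mod n = (k + b) mod n \<longleftrightarrow> a = b" if "a < n" "b < n" for a b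
    using that mod_shift_inj by blast
  have min': "x k < x (k + a)" if "0 < a" "a < n" for a
    using min[of "k + a"] shift[of a 0] that n by auto
  \<comment> \<open>No side is crossed by the two sides through the vertex \<open>k\<close>, as \<open>x k\<close> lies outside of all of them.\<close>
  have outside: "\<not> strictly_between (x (Suc (k + i))) (x (Suc (Suc (k + i)))) (x k)" if "Suc (Suc i) < n" for i
    using min'[of "Suc i"] min'[of "Suc (Suc i)"] that by (simp add: strictly_between_def min_def)
  define m where "m = n - 1"
  define w where "w i = x (Suc (k + i))" for i
  have window: "(k + a) mod n \<noteq> (k + b) mod n" if "a < b" "b < n" for a b
    using shift[of a b] that by auto
  have mono: "(\<forall>i. Suc i < m \<longrightarrow> w i < w (Suc i)) \<or> (\<forall>i. Suc i < m \<longrightarrow> w (Suc i) < w i)"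
  proof (rule noncrossing_path_monotone)
    show "inj_on w {..<m}"
      using shift[of "Suc _" "Suc _"] by (auto simp: inj_on_def w_def x_eq m_def)
    show "2 \<le> m" using n by (simp add: m_def)
  next
    fix i j assume *: "Suc i < m" "Suc j < m" "Suc i < j \<or> Suc j < i"
    have lt: "Suc i < n" "Suc (Suc i) < n" "Suc j < n" "Suc (Suc j) < n" using * by (auto simp: m_def)
    have "i \<noteq> j" "Suc i \<noteq> j" "i \<noteq> Suc j" using *(3) by linarith+
    then have "(k + Suc i) mod n \<noteq> (k + Suc j) mod n" "(k + Suc (Suc i)) mod n \<noteq> (k + Suc j) mod n"
      "(k + Suc i) mod n \<noteq> (k + Suc (Suc j)) mod n" "(k + Suc (Suc i)) mod n \<noteq> (k + Suc (Suc j)) mod n"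
      unfolding shift[OF lt(1,3)] shift[OF lt(2,3)] shift[OF lt(1,4)] shift[OF lt(2,4)] by simp_all
    then show "strictly_between (w i) (w (Suc i)) (w j) \<longleftrightarrow> strictly_between (w i) (w (Suc i)) (w (Suc j))"
      unfolding w_def add_Suc_right by (intro noncross) blast
  next
    fix i assume *: "Suc i < m" "0 < i"
    have "strictly_between (x (Suc (k+i))) (x (Suc (Suc (k+i)))) (x k) \<longleftrightarrow>
      strictly_between (x (Suc (k+i))) (x (Suc (Suc (k+i)))) (x (Suc k))"
      using * shift[of "Suc i" 0] shift[of "Suc (Suc i)" 0]
        shift[of "Suc i" "Suc 0"] shift[of "Suc (Suc i)" "Suc 0"]
      by (intro noncross) (auto simp: m_def)
    moreover have "\<not> strictly_between (x (Suc (k+i))) (x (Suc (Suc (k+i)))) (x k)"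
      using * by (intro outside) (simp add: m_def)
    ultimately show "\<not> strictly_between (w i) (w (Suc i)) (w 0)" by (simp add: w_def)
  next
    fix i assume *: "Suc (Suc i) < m"
    have last: "x (Suc (k + (n - 1))) = x k" using n by (simp add: x_eq)
    have "strictly_between (x (Suc (k+i))) (x (Suc (Suc (k+i)))) (x (k + (n - 1))) \<longleftrightarrow>
      strictly_between (x (Suc (k+i))) (x (Suc (Suc (k+i)))) (x (Suc (k + (n - 1))))"
      using * shift[of "Suc i" "n - 1"] shift[of "Suc (Suc i)" "n - 1"]
        shift[of "Suc i" "0"] shift[of "Suc (Suc i)" "0"] n
      by (intro noncross) (auto simp: m_def)
    moreover have "\<not> strictly_between (x (Suc (k+i))) (x (Suc (Suc (k+i)))) (x k)"
      using * by (intro outside) (simp add: m_def)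
    moreover have "w (m - 1) = x (k + (n - 1))"
    proof -
      have "Suc (k + (m - 1)) = k + (n - 1)" using n by (simp add: m_def)
      then show ?thesis unfolding w_def by (rule arg_cong)
    qed
    ultimately show "\<not> strictly_between (w i) (w (Suc i)) (w (m - 1))"
      unfolding last by (simp add: w_def)
  qed
  have wrap: "x (Suc (k + (n - 1))) = x k" using n by (simp add: x_eq)
  have goal: ?thesis if J: "J < n" "\<sigma> \<in> {1, -1}"
    and step: "\<And>a. a < n \<Longrightarrow> (k + a) mod n \<noteq> J \<Longrightarrow> \<sigma> * x (k + a) < \<sigma> * x (Suc (k + a))" for J \<sigma>
  proof -
    have "\<sigma> * t (P ! i) < \<sigma> * t (next_vertex P i)" if i: "i < n" "i \<noteq> J" for i
    proof -
      obtain a where a: "a < n" "i = (k + a) mod n" using mod_shift_surj[OF i(1) k(1)] .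
      have "x (Suc i) = x (Suc (k + a))" using a by (simp add: x_eq mod_Suc_eq)
      moreover have "t (P ! i) = x (k + a)" using a by (simp add: x_def p_def)
      ultimately show ?thesis using step[OF a(1)] a i by (simp add: next_x)
    qed
    then show ?thesis using J by (auto simp: n_def)
  qed
  from mono show ?thesis
  proof
    assume inc: "\<forall>i. Suc i < m \<longrightarrow> w i < w (Suc i)"
    show ?thesis
    proof (rule goal)
      \<comment> \<open>The descent occurs on the side that leads back to the least parameter.\<close>
      show "(k + (n - 1)) mod n < n" "(1::real) \<in> {1, -1}" using n by auto
      fix a assume a: "a < n" "(k + a) mod n \<noteq> (k + (n - 1)) mod n"
      then have a': "a < n - 1" using n by (cases "a = n - 1") auto
      show "1 * x (k + a) < 1 * x (Suc (k + a))"
      proof (cases a)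
        case 0
        then show ?thesis using min'[of 1] n by simp
      next
        case (Suc b)
        then show ?thesis using inc a' by (simp add: w_def m_def)
      qed
    qed
  next
    assume dec: "\<forall>i. Suc i < m \<longrightarrow> w (Suc i) < w i"
    show ?thesis
    proof (rule goal)
      \<comment> \<open>The ascent occurs on the side that leaves the least parameter.\<close>
      show "k < n" "(-1::real) \<in> {1, -1}" using k by auto
      fix a assume a: "a < n" "(k + a) mod n \<noteq> k"
      then obtain b where b: "a = Suc b" using k by (cases a) auto
      show "-1 * x (k + a) < -1 * x (Suc (k + a))"
      proof (cases "a = n - 1")
        case True
        then show ?thesis using min'[of a] a b wrap by simp
      next
        case False
        then show ?thesis using dec b a by (simp add: w_def m_def)
      qed
    qed
  qed
qed

text \<open>The isometry is determined by the first three vertices, and every other vertex is determined by its distances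
to these. Surjectivity comes from extending the inverse map of the three vertices.\<close>

lemma congruent_polygons_if_dist_eq:
  assumes len: "length P = n" "length P' = n" "3 \<le> n"
    and nz: "orient (P ! 0) (P ! 1) (P ! 2) \<noteq> 0" "orient (P' ! 0) (P' ! 1) (P' ! 2) \<noteq> 0"
    and eq: "\<And>i j. i < n \<Longrightarrow> j < n \<Longrightarrow> dist (P' ! i) (P' ! j) = dist (P ! i) (P ! j)"
  shows "congruent_polygons P P'"
proof -
  have eq3: "dist (P' ! 0) (P' ! 1) = dist (P ! 0) (P ! 1)"
    "dist (P' ! 0) (P' ! 2) = dist (P ! 0) (P ! 2)" "dist (P' ! 1) (P' ! 2) = dist (P ! 1) (P ! 2)"
    using len by (auto intro!: eq)
  obtain f where f: "f (P ! 0) = P' ! 0" "f (P ! 1) = P' ! 1" "f (P ! 2) = P' ! 2"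
    and fd: "\<And>x y. dist (f x) (f y) = dist x y"
    using three_point_extension[OF nz(1) eq3] by blast
  obtain g where g: "g (P' ! 0) = P ! 0" "g (P' ! 1) = P ! 1" "g (P' ! 2) = P ! 2"
    and gd: "\<And>x y. dist (g x) (g y) = dist x y"
    using three_point_extension[OF nz(2) eq3[symmetric]] by blast
  have "f (g y) = y" for y
    by (rule three_distances[OF nz(2)]) (metis f g fd gd)+
  moreover have "inj f" by (rule injI) (metis fd dist_eq_0_iff)
  ultimately have iso: "plane_isometry f"
    unfolding plane_isometry_def bij_def surj_def using fd by metis
  have fP: "f (P ! i) = P' ! i" if "i < n" for i
  proof (rule three_distances[OF nz(2)])
    have k: "0 < n" "1 < n" "2 < n" using len by auto
    show "dist (f (P ! i)) (P' ! 0) = dist (P' ! i) (P' ! 0)"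
      using fd[of "P ! i" "P ! 0"] eq[OF that k(1)] f(1) by simp
    show "dist (f (P ! i)) (P' ! 1) = dist (P' ! i) (P' ! 1)"
      using fd[of "P ! i" "P ! 1"] eq[OF that k(2)] f(2) by simp
    show "dist (f (P ! i)) (P' ! 2) = dist (P' ! i) (P' ! 2)"
      using fd[of "P ! i" "P ! 2"] eq[OF that k(3)] f(3) by simp
  qed
  have "f (next_vertex P i) = next_vertex P' i" for i
    using len fP[of "Suc i mod n"] by (simp add: next_vertex_def)
  then have sides: "f ` side P i = side P' i" if "i < n" for i
    using fP[OF that] by (simp add: side_def isometry_image_geo_segment[OF iso])
  then have "f ` polygon_curve P = polygon_curve P'"
    using len by (simp add: polygon_curve_def image_UN)
  then show ?thesis unfolding congruent_polygons_def using iso sides len by auto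
qed

end

section \<open>Chords determined by the sides\<close>

text \<open>The values of the parameter at the vertices of an inscribed polygon: they increase from vertex to vertex
except on the side \<open>J\<close>, where the parameter returns.\<close>

definition cyclically_increasing :: "nat \<Rightarrow> (nat \<Rightarrow> real) \<Rightarrow> nat \<Rightarrow> bool" where
  "cyclically_increasing n x J \<longleftrightarrow> 3 \<le> n \<and> J < n \<and> (\<forall>i<n. i \<noteq> J \<longrightarrow> x i < x (Suc i mod n))"

lemma sum_consecutive_differences:
  fixes x :: "nat \<Rightarrow> real"
  assumes "i < n"
  shows "(\<Sum>m<i. x (Suc m mod n) - x m) = x i - x 0"
proof -
  have "(\<Sum>m<i. x (Suc m mod n) - x m) = (\<Sum>m<i. x (Suc m) - x m)"
    using assms by (intro sum.cong) auto
  then show ?thesis by (simp add: sum_lessThan_telescope)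
qed

lemma sum_cyclic_differences:
  fixes x :: "nat \<Rightarrow> real"
  assumes "0 < n"
  shows "(\<Sum>m<n. x (Suc m mod n) - x m) = 0"
proof -
  obtain k where k: "n = Suc k" using assms by (cases n) auto
  then show ?thesis using sum_consecutive_differences[of k n x] by simp
qed

text \<open>All differences between consecutive values sum to zero, and only the one on the side \<open>J\<close> is negative; so its absolute
value is the sum of the other gaps, and it is the largest gap because there are at least two others.\<close>

lemma cyclically_increasing_gaps:
  assumes inc: "cyclically_increasing n x J"
  defines "\<alpha> \<equiv> \<lambda>i. \<bar>x i - x (Suc i mod n)\<bar>"
  shows "\<And>i. i < n \<Longrightarrow> x (Suc i mod n) - x i = (if i = J then - \<alpha> i else \<alpha> i)"
    and "\<And>i. i < n \<Longrightarrow> 0 < \<alpha> i"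
    and "\<alpha> J = sum \<alpha> ({..<n} - {J})"
    and "\<And>i. i < n \<Longrightarrow> i \<noteq> J \<Longrightarrow> \<alpha> i < \<alpha> J"
proof -
  have n: "3 \<le> n" and J: "J < n" and up: "\<And>i. i < n \<Longrightarrow> i \<noteq> J \<Longrightarrow> x i < x (Suc i mod n)"
    using inc by (auto simp: cyclically_increasing_def)
  let ?S = "{..<n} - {J}"
  have card: "card ?S = n - 1" using J by simp
  have ne: "?S \<noteq> {}" using card n by (intro notI) simp
  have "(\<Sum>m<n. x (Suc m mod n) - x m) = 0" using n by (intro sum_cyclic_differences) auto
  then have "x (Suc J mod n) - x J + (\<Sum>m\<in>?S. x (Suc m mod n) - x m) = 0"
    using sum_remove_lessThan[OF J, of "\<lambda>m. x (Suc m mod n) - x m"] by linarith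
  moreover have S: "(\<Sum>m\<in>?S. x (Suc m mod n) - x m) = sum \<alpha> ?S"
    using up by (intro sum.cong) (simp_all add: \<alpha>_def abs_of_neg)
  moreover have "0 < sum \<alpha> ?S" using ne up by (intro sum_pos) (auto simp: \<alpha>_def, force)
  ultimately have neg: "x (Suc J mod n) - x J < 0" "x J - x (Suc J mod n) = sum \<alpha> ?S"
    by linarith+
  show pos: "0 < \<alpha> i" if "i < n" for i
    using up[OF that] neg by (cases "i = J") (auto simp: \<alpha>_def)
  show "x (Suc i mod n) - x i = (if i = J then - \<alpha> i else \<alpha> i)" if "i < n" for i
    using up[OF that] neg by (auto simp: \<alpha>_def)
  show J_sum: "\<alpha> J = sum \<alpha> ?S" using neg by (simp add: \<alpha>_def)
  show "\<alpha> i < \<alpha> J" if i: "i < n" "i \<noteq> J" for i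
  proof -
    have "sum \<alpha> ?S = \<alpha> i + sum \<alpha> (?S - {i})" using i by (intro sum.remove) auto
    moreover have "card (?S - {i}) = n - 2" using i card by simp
    then have "?S - {i} \<noteq> {}" using n by (intro notI) simp
    then have "0 < sum \<alpha> (?S - {i})" using pos by (intro sum_pos) auto
    ultimately show ?thesis using J_sum by linarith
  qed
qed

text \<open>On a circle the parameter is an angle modulo \<open>\<pi>\<close>, so the gap of the side \<open>J\<close> is measured the other way round.
With this convention no side is distinguished any more and the gaps sum to \<open>\<pi>\<close>.\<close>

lemma circle_gaps:
  assumes inc: "cyclically_increasing n x J"
    and range: "\<And>i j. i < n \<Longrightarrow> j < n \<Longrightarrow> \<bar>x i - x j\<bar> < pi"
  obtains \<alpha> where "\<And>i. i < n \<Longrightarrow> 0 < \<alpha> i" "sum \<alpha> {..<n} = pi"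
    "\<And>i. i < n \<Longrightarrow> sin (\<alpha> i) = \<bar>sin (x i - x (Suc i mod n))\<bar>"
    "\<And>i j. i < n \<Longrightarrow> j < n \<Longrightarrow> \<bar>sin (x i - x j)\<bar> = \<bar>sin (sum \<alpha> {..<i} - sum \<alpha> {..<j})\<bar>"
proof -
  have n: "3 \<le> n" and J: "J < n" using inc by (auto simp: cyclically_increasing_def)
  define d where "d i = \<bar>x i - x (Suc i mod n)\<bar>" for i
  note gaps = cyclically_increasing_gaps[OF inc, folded d_def]
  define \<alpha> where "\<alpha> i = (if i = J then pi - d i else d i)" for i
  have d: "0 < d i" "d i < pi" if "i < n" for i
    using gaps(2)[OF that] range[OF that, of "Suc i mod n"] n by (auto simp: d_def)
  have pos: "0 < \<alpha> i" if "i < n" for i using d[OF that] by (cases "i = J") (simp_all add: \<alpha>_def)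
  have step: "\<alpha> m = (x (Suc m mod n) - x m) + (if m = J then pi else 0)" if "m < n" for m
    unfolding gaps(1)[OF that] \<alpha>_def by simp
  have partial: "sum \<alpha> {..<i} = (x i - x 0) + (if J < i then pi else 0)" if "i < n" for i
  proof -
    have "sum \<alpha> {..<i} = (\<Sum>m<i. (x (Suc m mod n) - x m) + (if m = J then pi else 0))"
      by (rule sum.cong[OF refl], rule step) (use that in simp)
    then show ?thesis
      unfolding sum.distrib sum_consecutive_differences[OF that] by simp
  qed
  have total: "sum \<alpha> {..<n} = pi"
  proof -
    have "sum \<alpha> {..<n} = (\<Sum>m<n. (x (Suc m mod n) - x m) + (if m = J then pi else 0))"
      by (rule sum.cong[OF refl], rule step) simp
    moreover have "(\<Sum>m<n. x (Suc m mod n) - x m) = 0" using J by (intro sum_cyclic_differences) auto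
    ultimately show ?thesis using J unfolding sum.distrib by simp
  qed
  show ?thesis
  proof (rule that[of \<alpha>])
    show "sin (\<alpha> i) = \<bar>sin (x i - x (Suc i mod n))\<bar>" if "i < n" for i
    proof -
      have "sin (\<alpha> i) = sin (d i)" by (simp add: \<alpha>_def)
      also have "\<dots> = \<bar>sin (d i)\<bar>" using d[OF that] sin_gt_zero[of "d i"] by simp
      also have "\<dots> = \<bar>sin (x i - x (Suc i mod n))\<bar>"
        unfolding d_def by (cases "0 \<le> x i - x (Suc i mod n)") (simp_all only: abs_of_nonneg abs_of_neg
          not_le sin_minus abs_minus_cancel)
      finally show ?thesis .
    qed
    show "\<bar>sin (x i - x j)\<bar> = \<bar>sin (sum \<alpha> {..<i} - sum \<alpha> {..<j})\<bar>" if "i < n" "j < n" for i j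
    proof -
      have e: "sum \<alpha> {..<i} - sum \<alpha> {..<j} =
        (x i - x j) + (if J < i then pi else 0) - (if J < j then pi else 0)"
        using partial[OF that(1)] partial[OF that(2)] by simp
      have "\<bar>sin (y - pi)\<bar> = \<bar>sin y\<bar>" "\<bar>sin (y + pi)\<bar> = \<bar>sin y\<bar>" for y :: real
        by (simp_all add: sin_diff sin_add)
      then show ?thesis unfolding e by auto
    qed
  qed (use pos total in auto)
qed

text \<open>For a circle the gap of any side is the supplement of the sum of the other gaps, and the sine is strictly
subadditive. Together with the next two lemmas this tells the types of curves apart by the lengths of the sides.\<close>

lemma circle_chord_less_sum:
  assumes inc: "cyclically_increasing n x J" and R: "0 < R"
    and range: "\<And>i j. i < n \<Longrightarrow> j < n \<Longrightarrow> \<bar>x i - x j\<bar> < pi"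
    and s: "\<And>i. i < n \<Longrightarrow> s i = R * \<bar>sin (x i - x (Suc i mod n))\<bar>" and j: "j < n"
  shows "s j < sum s ({..<n} - {j})"
proof -
  have n: "3 \<le> n" using inc by (auto simp: cyclically_increasing_def)
  obtain \<alpha> where \<alpha>: "\<And>i. i < n \<Longrightarrow> 0 < \<alpha> i" "sum \<alpha> {..<n} = pi"
    "\<And>i. i < n \<Longrightarrow> sin (\<alpha> i) = \<bar>sin (x i - x (Suc i mod n))\<bar>"
    "\<And>i j. i < n \<Longrightarrow> j < n \<Longrightarrow> \<bar>sin (x i - x j)\<bar> = \<bar>sin (sum \<alpha> {..<i} - sum \<alpha> {..<j})\<bar>"
    using circle_gaps[OF inc range] by blast
  let ?S = "{..<n} - {j}"
  have tot: "sum \<alpha> ?S = pi - \<alpha> j" using sum_remove_lessThan[OF j, of \<alpha>] \<alpha>(2) by linarith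
  have "sin (sum \<alpha> ?S) < (\<Sum>i\<in>?S. sin (\<alpha> i))"
  proof (rule strict_subadditive_sum)
    fix x y :: real assume xy: "0 < x" "0 < y" "x + y < pi"
    have "sin (x + y) = sin x * cos y + sin y * cos x" by (simp add: sin_add)
    also have "\<dots> < sin x * 1 + sin y * 1"
    proof (intro add_strict_mono mult_strict_left_mono)
      show "cos x < 1" "cos y < 1"
        using cos_monotone_0_pi[of 0 x] cos_monotone_0_pi[of 0 y] xy by auto
      show "0 < sin x" "0 < sin y" using xy by (auto intro: sin_gt_zero)
    qed
    finally show "sin (x + y) < sin x + sin y" by simp
  qed (use n j \<alpha> tot in auto)
  then have "R * sin (\<alpha> j) < R * (\<Sum>i\<in>?S. sin (\<alpha> i))" using tot R by simp
  also have "\<dots> = sum s ?S" using \<alpha>(3) s by (simp add: sum_distrib_left)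
  finally show ?thesis using \<alpha>(3)[OF j] s[OF j] by simp
qed

lemma horocycle_chord_sum:
  assumes inc: "cyclically_increasing n x J"
    and s: "\<And>i. i < n \<Longrightarrow> s i = \<bar>x i - x (Suc i mod n)\<bar>"
  shows "s J = sum s ({..<n} - {J})" and "j < n \<Longrightarrow> s j \<le> sum s ({..<n} - {j})"
proof -
  have J: "J < n" using inc by (auto simp: cyclically_increasing_def)
  note gaps = cyclically_increasing_gaps[OF inc]
  show eq: "s J = sum s ({..<n} - {J})"
    using gaps(3) s J by simp
  show "s j \<le> sum s ({..<n} - {j})" if j: "j < n"
  proof (cases "j = J")
    case False
    have "s j < s J" using gaps(4)[OF j False] s j J by simp
    also have "s J \<le> sum s ({..<n} - {j})"
      using J False s by (intro member_le_sum) auto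
    finally show ?thesis by simp
  qed (use eq in simp)
qed

lemma hypercycle_chord_greater_sum:
  assumes inc: "cyclically_increasing n x J" and c: "0 < c"
    and s: "\<And>i. i < n \<Longrightarrow> s i = c * sinh \<bar>x i - x (Suc i mod n)\<bar>"
  shows "sum s ({..<n} - {J}) < s J"
proof -
  have n: "3 \<le> n" and J: "J < n" using inc by (auto simp: cyclically_increasing_def)
  note gaps = cyclically_increasing_gaps[OF inc]
  let ?\<alpha> = "\<lambda>i. \<bar>x i - x (Suc i mod n)\<bar>" and ?S = "{..<n} - {J}"
  have "- sinh (sum ?\<alpha> ?S) < (\<Sum>i\<in>?S. - sinh (?\<alpha> i))"
  proof (rule strict_subadditive_sum[where b = "sum ?\<alpha> ?S + 1" and f = "\<lambda>u. - sinh u"])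
    fix x y :: real assume xy: "0 < x" "0 < y"
    have "sinh x * 1 + sinh y * 1 < sinh x * cosh y + sinh y * cosh x"
      using xy cosh_real_strict_mono[of 0 x] cosh_real_strict_mono[of 0 y]
      by (intro add_strict_mono mult_strict_left_mono) auto
    then show "- sinh (x + y) < - sinh x + - sinh y" by (simp add: sinh_add algebra_simps)
  qed (use n J gaps(2) in auto)
  then have "(\<Sum>i\<in>?S. sinh (?\<alpha> i)) < sinh (?\<alpha> J)" unfolding gaps(3) by (simp add: sum_negf)
  then have "c * (\<Sum>i\<in>?S. sinh (?\<alpha> i)) < c * sinh (?\<alpha> J)" using c by simp
  then show ?thesis using s J by (simp add: sum_distrib_left)
qed

lemma circle_chords_determined:
  assumes inc: "cyclically_increasing n x J" "cyclically_increasing n x' J'" and R: "0 < R" "0 < R'"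
    and range: "\<And>i j. i < n \<Longrightarrow> j < n \<Longrightarrow> \<bar>x i - x j\<bar> < pi"
      "\<And>i j. i < n \<Longrightarrow> j < n \<Longrightarrow> \<bar>x' i - x' j\<bar> < pi"
    and sides: "\<And>i. i < n \<Longrightarrow>
      R * \<bar>sin (x i - x (Suc i mod n))\<bar> = R' * \<bar>sin (x' i - x' (Suc i mod n))\<bar>"
    and ij: "i < n" "j < n"
  shows "R * \<bar>sin (x i - x j)\<bar> = R' * \<bar>sin (x' i - x' j)\<bar>"
proof -
  have n: "3 \<le> n" using inc by (auto simp: cyclically_increasing_def)
  obtain \<alpha> where \<alpha>: "\<And>i. i < n \<Longrightarrow> 0 < \<alpha> i" "sum \<alpha> {..<n} = pi"
    "\<And>i. i < n \<Longrightarrow> sin (\<alpha> i) = \<bar>sin (x i - x (Suc i mod n))\<bar>"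
    "\<And>i j. i < n \<Longrightarrow> j < n \<Longrightarrow> \<bar>sin (x i - x j)\<bar> = \<bar>sin (sum \<alpha> {..<i} - sum \<alpha> {..<j})\<bar>"
    using circle_gaps[OF inc(1) range(1)] by blast
  obtain \<alpha>' where \<alpha>': "\<And>i. i < n \<Longrightarrow> 0 < \<alpha>' i" "sum \<alpha>' {..<n} = pi"
    "\<And>i. i < n \<Longrightarrow> sin (\<alpha>' i) = \<bar>sin (x' i - x' (Suc i mod n))\<bar>"
    "\<And>i j. i < n \<Longrightarrow> j < n \<Longrightarrow> \<bar>sin (x' i - x' j)\<bar> = \<bar>sin (sum \<alpha>' {..<i} - sum \<alpha>' {..<j})\<bar>"
    using circle_gaps[OF inc(2) range(2)] by blast
  have eq: "R = R' \<and> (\<forall>i<n. \<alpha> i = \<alpha>' i)"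
    by (rule circle_angles_unique[OF n \<alpha>(1) \<alpha>'(1) \<alpha>(2) \<alpha>'(2) R])
      (use sides \<alpha>(3) \<alpha>'(3) in auto)
  have "sum \<alpha> {..<k} = sum \<alpha>' {..<k}" if "k < n" for k
    using eq that by (intro sum.cong) auto
  then show ?thesis using \<alpha>(4) \<alpha>'(4) ij eq by simp
qed

text \<open>The side \<open>J\<close> is recognisable as the one with the largest gap, so the signs of all differences are known.\<close>

lemma line_differences_determined:
  assumes inc: "cyclically_increasing n x J" "cyclically_increasing n x' J'"
    and sides: "\<And>i. i < n \<Longrightarrow> \<bar>x i - x (Suc i mod n)\<bar> = \<bar>x' i - x' (Suc i mod n)\<bar>"
    and ij: "i < n" "j < n"
  shows "\<bar>x i - x j\<bar> = \<bar>x' i - x' j\<bar>"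
proof -
  have J: "J < n" "J' < n" using inc by (auto simp: cyclically_increasing_def)
  note gaps = cyclically_increasing_gaps[OF inc(1)] and gaps' = cyclically_increasing_gaps[OF inc(2)]
  have "J = J'"
    using gaps(4)[of J'] gaps'(4)[of J] J sides by fastforce
  have step: "x (Suc m mod n) - x m = x' (Suc m mod n) - x' m" if "m < n" for m
    unfolding gaps(1)[OF that] gaps'(1)[OF that] sides[OF that] using \<open>J = J'\<close> by simp
  have "x k - x 0 = x' k - x' 0" if "k < n" for k
    unfolding sum_consecutive_differences[OF that, symmetric]
    by (rule sum.cong[OF refl], rule step) (use that in simp)
  from this[OF ij(1)] this[OF ij(2)] show ?thesis by linarith
qed

lemma hypercycle_chords_determined:
  assumes inc: "cyclically_increasing n x J" "cyclically_increasing n x' J'" and c: "0 < c" "0 < c'"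
    and sides: "\<And>i. i < n \<Longrightarrow>
      c * sinh \<bar>x i - x (Suc i mod n)\<bar> = c' * sinh \<bar>x' i - x' (Suc i mod n)\<bar>"
    and ij: "i < n" "j < n"
  shows "c * sinh \<bar>x i - x j\<bar> = c' * sinh \<bar>x' i - x' j\<bar>"
proof -
  have n: "3 \<le> n" and J: "J < n" "J' < n" using inc by (auto simp: cyclically_increasing_def)
  note gaps = cyclically_increasing_gaps[OF inc(1)] and gaps' = cyclically_increasing_gaps[OF inc(2)]
  have JJ: "J = J'"
  proof (rule ccontr)
    assume ne: "J \<noteq> J'"
    have "c * sinh \<bar>x J' - x (Suc J' mod n)\<bar> < c * sinh \<bar>x J - x (Suc J mod n)\<bar>"
      "c' * sinh \<bar>x' J - x' (Suc J mod n)\<bar> < c' * sinh \<bar>x' J' - x' (Suc J' mod n)\<bar>"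
      using gaps(4)[OF J(2) ne[symmetric]] gaps'(4)[OF J(1) ne] c
      by (simp_all only: mult_less_cancel_left_pos sinh_real_less_iff)
    then show False using sides[OF J(1)] sides[OF J(2)] by linarith
  qed
  have card: "finite ({..<n} - {J})" "2 \<le> card ({..<n} - {J})" using n J by auto
  have "\<not> c < c'"
    by (rule hypercycle_width_not_less[OF card _ gaps(3) gaps'(3)[folded JJ] c])
      (use gaps(2) sides J in auto)
  moreover have "\<not> c' < c"
    by (rule hypercycle_width_not_less[OF card _ gaps'(3)[folded JJ] gaps(3) c(2,1)])
      (use gaps'(2) sides J in auto)
  ultimately have cc: "c = c'" by simp
  have "\<bar>x i - x (Suc i mod n)\<bar> = \<bar>x' i - x' (Suc i mod n)\<bar>" if "i < n" for i
  proof -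
    have "sinh \<bar>x i - x (Suc i mod n)\<bar> = sinh \<bar>x' i - x' (Suc i mod n)\<bar>"
      using sides[OF that] c unfolding cc mult_cancel_left by (elim disjE) (simp, assumption)
    then show ?thesis unfolding sinh_real_eq_iff .
  qed
  then have "\<bar>x i - x j\<bar> = \<bar>x' i - x' j\<bar>" by (rule line_differences_determined[OF inc _ ij])
  then show ?thesis using cc by simp
qed

text \<open>In the following three definitions \<open>S i j\<close> is the half chord between the vertices \<open>i\<close> and \<open>j\<close>: half the distance in
the Euclidean plane, and the hyperbolic sine of half the distance in the hyperbolic plane.\<close>

definition circular_chords :: "nat \<Rightarrow> (nat \<Rightarrow> nat \<Rightarrow> real) \<Rightarrow> bool" where
  "circular_chords n S \<longleftrightarrow> (\<exists>x J R. cyclically_increasing n x J \<and> 0 < R \<and>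
     (\<forall>i<n. \<forall>j<n. \<bar>x i - x j\<bar> < pi \<and> S i j = R * \<bar>sin (x i - x j)\<bar>))"

definition horocyclic_chords :: "nat \<Rightarrow> (nat \<Rightarrow> nat \<Rightarrow> real) \<Rightarrow> bool" where
  "horocyclic_chords n S \<longleftrightarrow> (\<exists>x J. cyclically_increasing n x J \<and>
     (\<forall>i<n. \<forall>j<n. S i j = \<bar>x i - x j\<bar>))"

definition hypercyclic_chords :: "nat \<Rightarrow> (nat \<Rightarrow> nat \<Rightarrow> real) \<Rightarrow> bool" where
  "hypercyclic_chords n S \<longleftrightarrow> (\<exists>x J c. cyclically_increasing n x J \<and> 0 < c \<and>
     (\<forall>i<n. \<forall>j<n. S i j = c * sinh \<bar>x i - x j\<bar>))"

lemma circular_side_less_sum: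
  assumes "circular_chords n S" "j < n"
  shows "S j (Suc j mod n) < (\<Sum>i\<in>{..<n} - {j}. S i (Suc i mod n))"
proof -
  obtain x J R where *: "cyclically_increasing n x J" "0 < R"
    "\<And>i j. i < n \<Longrightarrow> j < n \<Longrightarrow> \<bar>x i - x j\<bar> < pi" "\<And>i j. i < n \<Longrightarrow> j < n \<Longrightarrow> S i j = R * \<bar>sin (x i - x j)\<bar>"
    using assms(1) unfolding circular_chords_def by blast
  show ?thesis
    by (rule circle_chord_less_sum[OF *(1,2) _ _ assms(2), where s = "\<lambda>i. S i (Suc i mod n)"])
      (use * assms(2) in auto)
qed

lemma horocyclic_side_sum:
  assumes "horocyclic_chords n S"
  shows "\<exists>j<n. S j (Suc j mod n) = (\<Sum>i\<in>{..<n} - {j}. S i (Suc i mod n))"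
    and "\<And>j. j < n \<Longrightarrow> S j (Suc j mod n) \<le> (\<Sum>i\<in>{..<n} - {j}. S i (Suc i mod n))"
proof -
  obtain x J where *: "cyclically_increasing n x J" "\<And>i j. i < n \<Longrightarrow> j < n \<Longrightarrow> S i j = \<bar>x i - x j\<bar>"
    using assms unfolding horocyclic_chords_def by blast
  have J: "J < n" using * by (simp add: cyclically_increasing_def)
  have s: "S i (Suc i mod n) = \<bar>x i - x (Suc i mod n)\<bar>" if "i < n" for i using * that by simp
  note sums = horocycle_chord_sum[OF *(1), where s = "\<lambda>i. S i (Suc i mod n)", OF s]
  show "\<exists>j<n. S j (Suc j mod n) = (\<Sum>i\<in>{..<n} - {j}. S i (Suc i mod n))"
    using sums(1) J by blast
  show "S j (Suc j mod n) \<le> (\<Sum>i\<in>{..<n} - {j}. S i (Suc i mod n))" if "j < n" for j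
    using sums(2) that by blast
qed

lemma hypercyclic_side_greater_sum:
  assumes "hypercyclic_chords n S"
  shows "\<exists>j<n. (\<Sum>i\<in>{..<n} - {j}. S i (Suc i mod n)) < S j (Suc j mod n)"
proof -
  obtain x J c where *: "cyclically_increasing n x J" "0 < c"
    "\<And>i j. i < n \<Longrightarrow> j < n \<Longrightarrow> S i j = c * sinh \<bar>x i - x j\<bar>"
    using assms unfolding hypercyclic_chords_def by blast
  have J: "J < n" using * by (simp add: cyclically_increasing_def)
  have s: "S i (Suc i mod n) = c * sinh \<bar>x i - x (Suc i mod n)\<bar>" if "i < n" for i using *(3) that by simp
  show ?thesis
    using hypercycle_chord_greater_sum[OF *(1,2), where s = "\<lambda>i. S i (Suc i mod n)", OF s] J by blast
qed

text \<open>By strict subadditivity of the sine, additivity of the identity and strict superadditivity of the hyperbolic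
sine, the comparison of the longest side with the sum of the others shows the type of the curve. Within one type
the radius or width is determined, hence the gaps, hence all chords.\<close>

lemma chords_determined_by_sides:
  assumes S: "circular_chords n S \<or> horocyclic_chords n S \<or> hypercyclic_chords n S"
    and S': "circular_chords n S' \<or> horocyclic_chords n S' \<or> hypercyclic_chords n S'"
    and sides: "\<And>i. i < n \<Longrightarrow> S i (Suc i mod n) = S' i (Suc i mod n)"
    and ij: "i < n" "j < n"
  shows "S i j = S' i j"
proof -
  have sum: "(\<Sum>i\<in>{..<n} - {j}. S i (Suc i mod n)) = (\<Sum>i\<in>{..<n} - {j}. S' i (Suc i mod n))" for j
    using sides by (intro sum.cong) auto
  have not_ch: "\<not> horocyclic_chords n B" "\<not> hypercyclic_chords n B"
    if A: "circular_chords n A" and AB: "\<And>i. i < n \<Longrightarrow> A i (Suc i mod n) = B i (Suc i mod n)"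
      and sum: "\<And>j. (\<Sum>i\<in>{..<n} - {j}. A i (Suc i mod n)) = (\<Sum>i\<in>{..<n} - {j}. B i (Suc i mod n))" for A B
    using circular_side_less_sum[OF A] AB sum horocyclic_side_sum(1)[of n B] hypercyclic_side_greater_sum[of n B]
    by (metis order_less_irrefl, metis order_less_asym)
  have not_h: "\<not> hypercyclic_chords n B"
    if A: "horocyclic_chords n A" and AB: "\<And>i. i < n \<Longrightarrow> A i (Suc i mod n) = B i (Suc i mod n)"
      and sum: "\<And>j. (\<Sum>i\<in>{..<n} - {j}. A i (Suc i mod n)) = (\<Sum>i\<in>{..<n} - {j}. B i (Suc i mod n))" for A B
    using horocyclic_side_sum(2)[OF A] AB sum hypercyclic_side_greater_sum[of n B] by (metis not_le)
  consider "circular_chords n S \<and> circular_chords n S'" | "horocyclic_chords n S \<and> horocyclic_chords n S'"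
    | "hypercyclic_chords n S \<and> hypercyclic_chords n S'"
    using S S' not_ch[of S S'] not_ch[of S' S] not_h[of S S'] not_h[of S' S] sides sum by metis
  then show ?thesis
  proof cases
    case 1
    obtain x J R where x: "cyclically_increasing n x J" "0 < R" "\<And>i j. i < n \<Longrightarrow> j < n \<Longrightarrow> \<bar>x i - x j\<bar> < pi"
      "\<And>i j. i < n \<Longrightarrow> j < n \<Longrightarrow> S i j = R * \<bar>sin (x i - x j)\<bar>"
      using 1 unfolding circular_chords_def by blast
    obtain x' J' R' where x': "cyclically_increasing n x' J'" "0 < R'" "\<And>i j. i < n \<Longrightarrow> j < n \<Longrightarrow> \<bar>x' i - x' j\<bar> < pi"
      "\<And>i j. i < n \<Longrightarrow> j < n \<Longrightarrow> S' i j = R' * \<bar>sin (x' i - x' j)\<bar>"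
      using 1 unfolding circular_chords_def by blast
    have "R * \<bar>sin (x i - x (Suc i mod n))\<bar> = R' * \<bar>sin (x' i - x' (Suc i mod n))\<bar>" if "i < n" for i
      using sides[OF that] x(4)[of i "Suc i mod n"] x'(4)[of i "Suc i mod n"] that by simp
    from circle_chords_determined[OF x(1) x'(1) x(2) x'(2) x(3) x'(3) this ij]
    show ?thesis using x(4)[OF ij] x'(4)[OF ij] by simp
  next
    case 2
    obtain x J where x: "cyclically_increasing n x J" "\<And>i j. i < n \<Longrightarrow> j < n \<Longrightarrow> S i j = \<bar>x i - x j\<bar>"
      using 2 unfolding horocyclic_chords_def by blast
    obtain x' J' where x': "cyclically_increasing n x' J'" "\<And>i j. i < n \<Longrightarrow> j < n \<Longrightarrow> S' i j = \<bar>x' i - x' j\<bar>"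
      using 2 unfolding horocyclic_chords_def by blast
    have "\<bar>x i - x (Suc i mod n)\<bar> = \<bar>x' i - x' (Suc i mod n)\<bar>" if "i < n" for i
      using sides[OF that] x(2)[of i "Suc i mod n"] x'(2)[of i "Suc i mod n"] that by simp
    from line_differences_determined[OF x(1) x'(1) this ij] show ?thesis using x(2)[OF ij] x'(2)[OF ij] by simp
  next
    case 3
    obtain x J c where x: "cyclically_increasing n x J" "0 < c" "\<And>i j. i < n \<Longrightarrow> j < n \<Longrightarrow> S i j = c * sinh \<bar>x i - x j\<bar>"
      using 3 unfolding hypercyclic_chords_def by blast
    obtain x' J' c' where x': "cyclically_increasing n x' J'" "0 < c'"
      "\<And>i j. i < n \<Longrightarrow> j < n \<Longrightarrow> S' i j = c' * sinh \<bar>x' i - x' j\<bar>"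
      using 3 unfolding hypercyclic_chords_def by blast
    have "c * sinh \<bar>x i - x (Suc i mod n)\<bar> = c' * sinh \<bar>x' i - x' (Suc i mod n)\<bar>" if "i < n" for i
    proof -
      have "Suc i mod n < n" using that by simp
      from x(3)[OF that this] x'(3)[OF that this] sides[OF that] show ?thesis by (simp only:)
    qed
    from hypercycle_chords_determined[OF x(1) x'(1) x(2) x'(2) this ij]
    show ?thesis unfolding x(3)[OF ij] x'(3)[OF ij] .
  qed
qed

context oriented_plane
begin

lemma inscribed_polygon_orient_nonzero:
  assumes "simple_polygon P" "convex_chart K t" "set P \<subseteq> K"
  shows "orient (P ! 0) (P ! 1) (P ! 2) \<noteq> 0"
proof (rule convex_chart_orient_nonzero[OF assms(2)])
  have P: "3 \<le> length P" "distinct P" using assms(1) by (auto simp: simple_polygon_def)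
  then have "0 < length P" "1 < length P" "2 < length P" by linarith+
  then show "P ! 0 \<noteq> P ! 1" "P ! 0 \<noteq> P ! 2" "P ! 1 \<noteq> P ! 2"
    using nth_eq_iff_index_eq[OF P(2)] by (metis zero_neq_one, metis zero_neq_numeral, metis numeral_eq_one_iff semiring_norm(85))
  have "P ! i \<in> K" if "i < 3" for i using assms(3) P that by (meson less_le_trans nth_mem subsetD)
  then show "P ! 0 \<in> K" "P ! 1 \<in> K" "P ! 2 \<in> K" by simp_all
qed

text \<open>If the parameter decreases along the polygon, its negative is taken, which does not affect the lengths of chords.\<close>

lemma inscribed_polygon_parameters:
  assumes simple: "simple_polygon P" and chart: "convex_chart K t" and K: "set P \<subseteq> K"
  obtains x J where "cyclically_increasing (length P) x J"
    "\<And>i j. \<bar>x i - x j\<bar> = \<bar>t (P ! i) - t (P ! j)\<bar>"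
    "\<And>i j. \<bar>sin (x i - x j)\<bar> = \<bar>sin (t (P ! i) - t (P ! j))\<bar>"
proof -
  obtain J \<sigma> where J: "J < length P" and \<sigma>: "\<sigma> = 1 \<or> \<sigma> = -1"
    and inc: "\<And>i. i < length P \<Longrightarrow> i \<noteq> J \<Longrightarrow> \<sigma> * t (P ! i) < \<sigma> * t (next_vertex P i)"
    using inscribed_polygon_monotone[OF assms] by blast
  define x where "x i = \<sigma> * t (P ! i)" for i
  have "cyclically_increasing (length P) x J"
    using simple J inc by (simp add: cyclically_increasing_def simple_polygon_def x_def next_vertex_def)
  moreover have d: "x i - x j = \<sigma> * (t (P ! i) - t (P ! j))" for i j by (simp add: x_def right_diff_distrib)
  have "\<bar>x i - x j\<bar> = \<bar>t (P ! i) - t (P ! j)\<bar>" for i j unfolding d using \<sigma> by auto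
  moreover have "\<bar>sin (\<sigma> * y)\<bar> = \<bar>sin y\<bar>" for y using \<sigma> by auto
  then have "\<bar>sin (x i - x j)\<bar> = \<bar>sin (t (P ! i) - t (P ! j))\<bar>" for i j unfolding d .
  ultimately show ?thesis by (rule that)
qed

end

section \<open>The Euclidean plane\<close>

text \<open>The polar angle is halved in order to have half-angles, with period \<open>\<pi>\<close>, as parameters: a chord is
  the sine of a difference of half-angles.\<close>

lemma polar_double_angle:
  assumes "x\<^sup>2 + y\<^sup>2 = r\<^sup>2" "0 < (r::real)"
  obtains t where "0 \<le> t" "t < pi" "x = r * cos (2 * t)" "y = r * sin (2 * t)"
proof -
  have "(x/r)\<^sup>2 + (y/r)\<^sup>2 = 1" using assms by (simp add: power_divide add_divide_distrib[symmetric])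
  then obtain s where s: "0 \<le> s" "s < 2 * pi" "x/r = cos s" "y/r = sin s" by (rule sincos_total_2pi)
  show ?thesis
  proof (rule that[of "s/2"])
    show "x = r * cos (2 * (s/2))" "y = r * sin (2 * (s/2))"
      using s(3,4) assms(2) by (simp_all add: divide_eq_eq mult.commute)
  qed (use s in simp_all)
qed

lemma circle_determinant:
  fixes s t u :: real
  shows "(cos (2 * t) - cos (2 * s)) * (sin (2 * u) - sin (2 * s)) - (sin (2 * t) - sin (2 * s)) * (cos (2 * u) - cos (2 * s))
    = 4 * sin (t - s) * sin (u - t) * sin (u - s)"
proof -
  have half: "(2 * x + 2 * s) / 2 = x + s" "(2 * x - 2 * s) / 2 = x - s" "(2 * s - 2 * x) / 2 = - (x - s)" for x
    by simp_all
  have c: "cos (2 * x) - cos (2 * s) = - 2 * sin (x + s) * sin (x - s)" for x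
    unfolding cos_diff_cos half sin_minus by simp
  have s: "sin (2 * x) - sin (2 * s) = 2 * cos (x + s) * sin (x - s)" for x
    unfolding sin_diff_sin half by simp
  have e: "sin (u - t) = sin (u + s) * cos (t + s) - cos (u + s) * sin (t + s)"
    using sin_diff[of "u + s" "t + s"] by simp
  show ?thesis unfolding c s e by (simp add: algebra_simps)
qed

definition orient2 :: "real ^ 2 \<Rightarrow> real ^ 2 \<Rightarrow> real ^ 2 \<Rightarrow> real" where
  "orient2 a b c = (b$1 - a$1) * (c$2 - a$2) - (b$2 - a$2) * (c$1 - a$1)"

lemma dist_power2_vec2: "(dist x y)\<^sup>2 = (x$1 - y$1)\<^sup>2 + (x$2 - y$2)\<^sup>2" for x y :: "real ^ 2"
  by (simp add: dist_norm norm_vec_def L2_set_def sum_2)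

interpretation euclid: oriented_plane orient2
proof
  fix a b c d x y a' b' c' :: "real ^ 2"
  show "orient2 b a c = - orient2 a b c" "orient2 a c b = - orient2 a b c"
    by (simp_all add: orient2_def algebra_simps)
  show "geo_segment a c \<inter> geo_segment b d \<noteq> {}"
    if pos: "0 < orient2 a b c" "0 < orient2 a b d" "0 < orient2 a c d" "0 < orient2 b c d"
  proof -
    \<comment> \<open>The affine dependence of the four points, given by Cramer's rule, has alternating signs here. Its two
      sides, divided by their total weight \<open>S\<close>, describe the same point on both diagonals.\<close>
    define S where "S = orient2 b c d + orient2 a b d"
    have S: "S = orient2 a c d + orient2 a b c" "0 < S"
      using pos by (auto simp: S_def orient2_def algebra_simps)
    define w where "w = (orient2 b c d / S) *\<^sub>R a + (orient2 a b d / S) *\<^sub>R c"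
    have "orient2 b c d *\<^sub>R a + orient2 a b d *\<^sub>R c = orient2 a c d *\<^sub>R b + orient2 a b c *\<^sub>R d"
      by (simp add: vec_eq_iff forall_2 orient2_def algebra_simps)
    then have "inverse S *\<^sub>R (orient2 b c d *\<^sub>R a + orient2 a b d *\<^sub>R c) =
      inverse S *\<^sub>R (orient2 a c d *\<^sub>R b + orient2 a b c *\<^sub>R d)" by simp
    then have w: "w = (orient2 a c d / S) *\<^sub>R b + (orient2 a b c / S) *\<^sub>R d"
      by (simp add: w_def scaleR_add_right divide_inverse mult.commute)
    have "orient2 b c d / S + orient2 a b d / S = 1" "orient2 a c d / S + orient2 a b c / S = 1"
      using S by (simp_all add: add_divide_distrib[symmetric] S_def)
    moreover have "k *\<^sub>R p + l *\<^sub>R q \<in> closed_segment p q" if "k + l = 1" "0 \<le> k" "0 \<le> l" for k l and p q :: "real ^ 2"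
    proof -
      have "k = 1 - l" "l \<le> 1" using that by auto
      then show ?thesis unfolding closed_segment_def using that by blast
    qed
    ultimately have "w \<in> closed_segment a c" "(orient2 a c d / S) *\<^sub>R b + (orient2 a b c / S) *\<^sub>R d \<in> closed_segment b d"
      unfolding w_def using pos S(2) by simp_all
    then show ?thesis unfolding geo_segment_eq_closed_segment w[symmetric] by blast
  qed
  show "x = y" if nz: "orient2 a b c \<noteq> 0"
    and d: "dist x a = dist y a" "dist x b = dist y b" "dist x c = dist y c"
  proof -
    have e: "(x$1 - p$1)\<^sup>2 + (x$2 - p$2)\<^sup>2 = (y$1 - p$1)\<^sup>2 + (y$2 - p$2)\<^sup>2" if "dist x p = dist y p" for p
      using that by (metis dist_power2_vec2)
    have "2 * (x$1 - y$1) * orient2 a b c = 0" "2 * (x$2 - y$2) * orient2 a b c = 0"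
      using e[OF d(1)] e[OF d(2)] e[OF d(3)] unfolding orient2_def by algebra+
    then show ?thesis using nz by (simp add: vec_eq_iff forall_2)
  qed
  show "\<exists>f. f a = a' \<and> f b = b' \<and> f c = c' \<and> (\<forall>x y. dist (f x) (f y) = dist x y)"
    if nz: "orient2 a b c \<noteq> 0"
      and d: "dist a' b' = dist a b" "dist a' c' = dist a c" "dist b' c' = dist b c"
  proof -
    \<comment> \<open>Affine coordinates of \<open>x\<close> with respect to the triangle \<open>a b c\<close>.\<close>
    define s t where "s x = orient2 a x c / orient2 a b c" and "t x = orient2 a b x / orient2 a b c" for x
    define f where "f x = a' + s x *\<^sub>R (b' - a') + t x *\<^sub>R (c' - a')" for x
    have x: "x = a + s x *\<^sub>R (b - a) + t x *\<^sub>R (c - a)" for x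
    proof -
      have "orient2 a b c * (x$1 - a$1) = orient2 a x c * (b$1 - a$1) + orient2 a b x * (c$1 - a$1)"
        "orient2 a b c * (x$2 - a$2) = orient2 a x c * (b$2 - a$2) + orient2 a b x * (c$2 - a$2)"
        unfolding orient2_def by algebra+
      moreover have "p = (A / D) * u + (B / D) * v" if "D \<noteq> 0" "D * p = A * u + B * v" for p A B D u v :: real
        using that by (simp add: field_simps)
      ultimately have "x$1 - a$1 = s x * (b$1 - a$1) + t x * (c$1 - a$1)"
        "x$2 - a$2 = s x * (b$2 - a$2) + t x * (c$2 - a$2)"
        unfolding s_def t_def using nz by blast+
      then show ?thesis by (simp add: vec_eq_iff forall_2 diff_eq_eq)
    qed
    have st: "s a = 0" "t a = 0" "s b = 1" "t b = 0" "s c = 0" "t c = 1"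
      using nz by (simp_all add: s_def t_def) (simp_all add: orient2_def)
    have n: "norm (b' - a') = norm (b - a)" "norm (c' - a') = norm (c - a)"
      "norm ((b' - a') - (c' - a')) = norm ((b - a) - (c - a))"
      using d by (simp_all add: dist_norm norm_minus_commute)
    have i: "(b' - a') \<bullet> (c' - a') = (b - a) \<bullet> (c - a)" unfolding dot_norm_neg n by simp
    have expand: "(norm (k *\<^sub>R u + l *\<^sub>R v))\<^sup>2 = k\<^sup>2 * (norm u)\<^sup>2 + l\<^sup>2 * (norm v)\<^sup>2 + 2 * k * l * (u \<bullet> v)"
      for k l and u v :: "real ^ 2"
      unfolding power2_norm_eq_inner
      by (simp add: inner_simps inner_commute[of v u] power2_eq_square algebra_simps)
    have "dist (f x) (f y) = dist x y" for x y
    proof -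
      have "f x - f y = (s x - s y) *\<^sub>R (b' - a') + (t x - t y) *\<^sub>R (c' - a')"
        by (simp add: f_def algebra_simps)
      moreover have "x - y = (s x - s y) *\<^sub>R (b - a) + (t x - t y) *\<^sub>R (c - a)"
      proof -
        have "x - y = (a + s x *\<^sub>R (b - a) + t x *\<^sub>R (c - a)) - (a + s y *\<^sub>R (b - a) + t y *\<^sub>R (c - a))"
          by (rule arg_cong2[where f = minus, OF x[of x] x[of y]])
        then show ?thesis by (simp only: scaleR_left_diff_distrib) simp
      qed
      ultimately have "(norm (f x - f y))\<^sup>2 = (norm (x - y))\<^sup>2" by (simp only: expand n i)
      then show ?thesis by (simp add: dist_norm power2_eq_iff_nonneg)
    qed
    then show ?thesis using st by (intro exI[of _ f]) (simp add: f_def)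
  qed
qed

lemma euclidean_circle_chart:
  assumes "0 < r" "K = sphere (c :: real ^ 2) r"
  obtains t where "euclid.convex_chart K t" "\<And>p. p \<in> K \<Longrightarrow> 0 \<le> t p \<and> t p < pi"
    "\<And>p q. p \<in> K \<Longrightarrow> q \<in> K \<Longrightarrow> dist p q / 2 = r * \<bar>sin (t p - t q)\<bar>"
proof -
  have "\<exists>t. 0 \<le> t \<and> t < pi \<and> p$1 = c$1 + r * cos (2 * t) \<and> p$2 = c$2 + r * sin (2 * t)" if "p \<in> K" for p
  proof -
    have "(p$1 - c$1)\<^sup>2 + (p$2 - c$2)\<^sup>2 = r\<^sup>2"
      using that assms dist_power2_vec2[of p c] by (simp add: dist_commute)
    then obtain t where "0 \<le> t" "t < pi" "p$1 - c$1 = r * cos (2 * t)" "p$2 - c$2 = r * sin (2 * t)"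
      using polar_double_angle assms(1) by blast
    then show ?thesis by (intro exI[of _ t]) auto
  qed
  then obtain t where t: "\<And>p. p \<in> K \<Longrightarrow> 0 \<le> t p \<and> t p < pi"
    and p: "\<And>p. p \<in> K \<Longrightarrow> p$1 = c$1 + r * cos (2 * t p)" "\<And>p. p \<in> K \<Longrightarrow> p$2 = c$2 + r * sin (2 * t p)"
    by metis
  have chord: "dist p q / 2 = r * \<bar>sin (t p - t q)\<bar>" if "p \<in> K" "q \<in> K" for p q
  proof -
    have sq: "(cos (2 * u) - cos (2 * v))\<^sup>2 + (sin (2 * u) - sin (2 * v))\<^sup>2 = (2 * \<bar>sin (u - v)\<bar>)\<^sup>2" for u v :: real
    proof -
      have "(sin u)\<^sup>2 + (cos u)\<^sup>2 = 1" "(sin v)\<^sup>2 + (cos v)\<^sup>2 = 1" by auto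
      then show ?thesis unfolding power_mult_distrib power2_abs cos_double sin_double sin_diff by algebra
    qed
    have "(dist p q)\<^sup>2 = r\<^sup>2 * ((cos (2 * t p) - cos (2 * t q))\<^sup>2 + (sin (2 * t p) - sin (2 * t q))\<^sup>2)"
      unfolding dist_power2_vec2 p[OF that(1)] p[OF that(2)] by algebra
    then have "(dist p q)\<^sup>2 = (r * (2 * \<bar>sin (t p - t q)\<bar>))\<^sup>2" unfolding sq by (simp add: power_mult_distrib)
    then show ?thesis using assms(1) by (simp add: power2_eq_iff_nonneg)
  qed
  have "euclid.convex_chart K t"
    unfolding euclid.convex_chart_def
  proof (intro conjI exI[of _ 1] ballI impI)
    show "inj_on t K"
      using chord by (intro inj_onI) (metis diff_self sin_zero abs_zero mult_zero_right divide_eq_0_iff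
        dist_eq_0_iff zero_neq_numeral)
    fix x y z assume K: "x \<in> K" "y \<in> K" "z \<in> K" and lt: "t x < t y" "t y < t z"
    have "orient2 x y z = r\<^sup>2 * ((cos (2 * t y) - cos (2 * t x)) * (sin (2 * t z) - sin (2 * t x)) -
      (sin (2 * t y) - sin (2 * t x)) * (cos (2 * t z) - cos (2 * t x)))"
      unfolding orient2_def K[THEN p(1)] K[THEN p(2)] by algebra
    moreover have "0 < sin (t y - t x)" "0 < sin (t z - t y)" "0 < sin (t z - t x)"
      using lt t[OF K(1)] t[OF K(3)] by (auto intro!: sin_gt_zero)
    ultimately show "0 < 1 * orient2 x y z" unfolding circle_determinant using assms(1) by simp
  qed
  then show ?thesis using that t chord by blast
qed

lemma euclidean_cyclic_polygon:
  assumes "simple_polygon P" "euclidean_cyclic P"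
  shows "circular_chords (length P) (\<lambda>i j. dist (P ! i) (P ! j) / 2)"
    and "orient2 (P ! 0) (P ! 1) (P ! 2) \<noteq> 0"
proof -
  obtain c r where r: "0 < r" and P: "set P \<subseteq> sphere c r" using assms(2) by (auto simp: euclidean_cyclic_def)
  obtain t where chart: "euclid.convex_chart (sphere c r) t" and t: "\<And>p. p \<in> sphere c r \<Longrightarrow> 0 \<le> t p \<and> t p < pi"
    and chord: "\<And>p q. p \<in> sphere c r \<Longrightarrow> q \<in> sphere c r \<Longrightarrow> dist p q / 2 = r * \<bar>sin (t p - t q)\<bar>"
    using euclidean_circle_chart[OF r refl] by blast
  have PK: "P ! i \<in> sphere c r" if "i < length P" for i using P that nth_mem by blast
  obtain x J where x: "cyclically_increasing (length P) x J"
    "\<And>i j. \<bar>x i - x j\<bar> = \<bar>t (P ! i) - t (P ! j)\<bar>" "\<And>i j. \<bar>sin (x i - x j)\<bar> = \<bar>sin (t (P ! i) - t (P ! j))\<bar>"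
    using euclid.inscribed_polygon_parameters[OF assms(1) chart P] by blast
  have "\<bar>x i - x j\<bar> < pi \<and> dist (P ! i) (P ! j) / 2 = r * \<bar>sin (x i - x j)\<bar>" if "i < length P" "j < length P" for i j
    using t[OF PK[OF that(1)]] t[OF PK[OF that(2)]] chord[OF PK[OF that(1)] PK[OF that(2)]] x(2,3)[of i j]
    by (simp add: abs_if split: if_splits)
  then show "circular_chords (length P) (\<lambda>i j. dist (P ! i) (P ! j) / 2)"
    unfolding circular_chords_def using x(1) r by blast
  show "orient2 (P ! 0) (P ! 1) (P ! 2) \<noteq> 0"
    by (rule euclid.inscribed_polygon_orient_nonzero[OF assms(1) chart P])
qed

section \<open>The hyperboloid model\<close>

type_synonym vec3 = "real \<times> real \<times> real"

definition lorentz :: "vec3 \<Rightarrow> vec3 \<Rightarrow> real" where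
  "lorentz u v = fst u * fst v - fst (snd u) * fst (snd v) - snd (snd u) * snd (snd v)"

definition volume :: "vec3 \<Rightarrow> vec3 \<Rightarrow> vec3 \<Rightarrow> real" where
  "volume u v w =
     fst u * (fst (snd v) * snd (snd w) - snd (snd v) * fst (snd w))
   - fst (snd u) * (fst v * snd (snd w) - snd (snd v) * fst w)
   + snd (snd u) * (fst v * fst (snd w) - fst (snd v) * fst w)"

lemma lorentz_simps:
  "lorentz (u + u') v = lorentz u v + lorentz u' v" "lorentz v (u + u') = lorentz v u + lorentz v u'"
  "lorentz (u - u') v = lorentz u v - lorentz u' v" "lorentz v (u - u') = lorentz v u - lorentz v u'"
  "lorentz (k *\<^sub>R u) v = k * lorentz u v" "lorentz v (k *\<^sub>R u) = k * lorentz v u"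
  by (simp_all add: lorentz_def algebra_simps)

lemma lorentz_commute: "lorentz u v = lorentz v u"
  by (simp add: lorentz_def mult.commute)

lemma vec3_eq_iff: "u = v \<longleftrightarrow> fst u = fst v \<and> fst (snd u) = fst (snd v) \<and> snd (snd u) = snd (snd (v :: vec3))"
  by (auto simp: prod_eq_iff)

lemma cramer:
  "volume a b c *\<^sub>R v = volume v b c *\<^sub>R a + volume a v c *\<^sub>R b + volume a b v *\<^sub>R c"
  unfolding vec3_eq_iff by (simp add: volume_def; safe; algebra)

text \<open>Linearly independent vectors leave only the zero vector orthogonal to all of them, so that a point of the
hyperbolic plane is determined by its distances to three points with nonzero \<open>volume\<close>.\<close>

lemma lorentz_nondegenerate:
  assumes "volume a b c \<noteq> 0" "lorentz v a = 0" "lorentz v b = 0" "lorentz v c = 0"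
  shows "v = 0"
proof -
  have "fst v * volume a b c = 0" "fst (snd v) * volume a b c = 0" "snd (snd v) * volume a b c = 0"
    using assms(2-4) unfolding lorentz_def volume_def by algebra+
  then show ?thesis using assms(1) by (simp add: vec3_eq_iff)
qed

lemma volume_power2_gram:
  "(volume a b c)\<^sup>2 =
     lorentz a a * (lorentz b b * lorentz c c - (lorentz b c)\<^sup>2)
   - lorentz a b * (lorentz a b * lorentz c c - lorentz b c * lorentz a c)
   + lorentz a c * (lorentz a b * lorentz b c - lorentz b b * lorentz a c)"
  unfolding lorentz_def volume_def by algebra

text \<open>The isometry from the half-plane model onto the hyperboloid model: the sheet \<open>fst v > 0\<close> of
\<open>lorentz v v = 1\<close>, with \<open>lorentz u v\<close> as the hyperbolic cosine of the distance.\<close>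

definition hyp_lift :: "hyp_plane \<Rightarrow> vec3" where
  "hyp_lift p = (1 / Im (hp_coord p)) *\<^sub>R
     ((1 + (cmod (hp_coord p))\<^sup>2) / 2, ((cmod (hp_coord p))\<^sup>2 - 1) / 2, Re (hp_coord p))"

lemma lorentz_hyp_lift: "lorentz (hyp_lift p) (hyp_lift q) = cosh (dist p q)"
proof -
  note pos = Im_hp_coord_pos[of p] Im_hp_coord_pos[of q]
  have "lorentz (hyp_lift p) (hyp_lift q) = hyp_cosh_dist (hp_coord p) (hp_coord q)"
    using pos unfolding lorentz_def hyp_lift_def hyp_cosh_dist_def cmod_power2
    by (simp add: divide_simps) algebra
  then show ?thesis using hyp_cosh_dist_ge_1[OF pos] by (simp add: dist_hyp_plane_def)
qed

lemma hyp_lift_norm: "lorentz (hyp_lift p) (hyp_lift p) = 1"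
  by (simp add: lorentz_hyp_lift)

lemma fst_hyp_lift_pos: "0 < fst (hyp_lift p)"
  using Im_hp_coord_pos[of p] by (simp add: hyp_lift_def add_pos_nonneg)

lemma hyp_lift_inject: "hyp_lift p = hyp_lift q \<longleftrightarrow> p = q"
proof
  assume "hyp_lift p = hyp_lift q"
  then have "cosh (dist p q) = 1" using lorentz_hyp_lift[of p q] hyp_lift_norm[of q] by simp
  then show "p = q" by simp
qed simp

lemma hyp_lift_surj:
  assumes "lorentz v v = 1" "0 < fst v"
  obtains p where "hyp_lift p = v"
proof -
  obtain T X Y where v: "v = (T, X, Y)" by (cases v)
  have n: "T * T = 1 + X * X + Y * Y" and T: "0 < T" using assms by (auto simp: v lorentz_def)
  have "X\<^sup>2 < T\<^sup>2" using n by (simp add: power2_eq_square add_pos_nonneg)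
  then have d: "0 < T - X" using T power2_less_imp_less[of X T] by simp
  define z where "z = Complex (Y / (T - X)) (1 / (T - X))"
  have "Im z > 0" using d by (simp add: z_def)
  then have z: "hp_coord (hp_point z) = z" by (simp add: hp_point_inverse)
  have "(cmod z)\<^sup>2 = (Y * Y + 1) / (T - X)\<^sup>2"
    unfolding cmod_power2 by (simp add: z_def power_divide power2_eq_square add_divide_distrib)
  also have "Y * Y + 1 = (T - X) * (T + X)" using n by (simp add: algebra_simps)
  also have "\<dots> / (T - X)\<^sup>2 = (T + X) / (T - X)" using d by (simp add: power2_eq_square)
  finally have "(cmod z)\<^sup>2 = (T + X) / (T - X)" .
  then have "hyp_lift (hp_point z) =
      (T - X) *\<^sub>R ((1 + (T + X) / (T - X)) / 2, ((T + X) / (T - X) - 1) / 2, Y / (T - X))"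
    unfolding hyp_lift_def z by (simp add: z_def)
  also have "\<dots> = v" using d by (simp add: v field_simps)
  finally show ?thesis by (rule that)
qed

text \<open>By the reversed Cauchy-Schwarz inequality, unit timelike vectors on opposite sheets have a negative product.\<close>

lemma future_cone:
  assumes "lorentz v v = 1" "0 < lorentz v (hyp_lift p)"
  shows "0 < fst v"
proof (rule ccontr)
  assume neg: "\<not> 0 < fst v"
  obtain T X Y where v: "v = (T, X, Y)" by (cases v)
  obtain t x y where p: "hyp_lift p = (t, x, y)" by (cases "hyp_lift p")
  have n: "T\<^sup>2 = 1 + X\<^sup>2 + Y\<^sup>2" "t\<^sup>2 = 1 + x\<^sup>2 + y\<^sup>2"
    using assms(1) hyp_lift_norm[of p] by (auto simp: v p lorentz_def power2_eq_square)
  have t: "0 < t" using fst_hyp_lift_pos[of p] by (simp add: p)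
  have "0 \<le> - T * t" using neg t by (simp add: v mult_nonpos_nonneg)
  moreover have "- T * t < - (X * x + Y * y)" using assms(2) by (simp add: v p lorentz_def)
  ultimately have "(- T * t)\<^sup>2 < (- (X * x + Y * y))\<^sup>2" by (intro power_strict_mono) auto
  then have "T\<^sup>2 * t\<^sup>2 < (X * x + Y * y)\<^sup>2" by (simp only: power_mult_distrib power2_minus)
  then have "(1 + X\<^sup>2 + Y\<^sup>2) * (1 + x\<^sup>2 + y\<^sup>2) < (X * x + Y * y)\<^sup>2" unfolding n .
  moreover have "(X * x + Y * y)\<^sup>2 + (X * y - Y * x)\<^sup>2 = (X\<^sup>2 + Y\<^sup>2) * (x\<^sup>2 + y\<^sup>2)" by algebra
  moreover have "(1 + X\<^sup>2 + Y\<^sup>2) * (1 + x\<^sup>2 + y\<^sup>2) = 1 + X\<^sup>2 + Y\<^sup>2 + x\<^sup>2 + y\<^sup>2 + (X\<^sup>2 + Y\<^sup>2) * (x\<^sup>2 + y\<^sup>2)"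
    by algebra
  ultimately show False
    using zero_le_power2[of X] zero_le_power2[of Y] zero_le_power2[of x] zero_le_power2[of y]
      zero_le_power2[of "X * y - Y * x"] by linarith
qed

text \<open>Geodesic segments are the radial projections of straight segments. Both sinh factors of the addition theorem
for \<open>cosh (dist p x + dist x q)\<close> are multiples of \<open>sinh (dist p q)\<close>, with the factors \<open>l\<close> and \<open>k\<close>.\<close>

lemma geo_segment_hyp_lift:
  assumes x: "hyp_lift x = k *\<^sub>R hyp_lift p + l *\<^sub>R hyp_lift q" and kl: "0 \<le> k" "0 \<le> l"
  shows "x \<in> geo_segment p q"
proof -
  define C where "C = cosh (dist p q)"
  have px: "cosh (dist p x) = k + l * C"
    using lorentz_hyp_lift[of p x] unfolding x by (simp add: lorentz_simps lorentz_hyp_lift C_def)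
  have xq: "cosh (dist x q) = k * C + l"
    using lorentz_hyp_lift[of x q] unfolding x by (simp add: lorentz_simps lorentz_hyp_lift C_def)
  have one: "k\<^sup>2 + l\<^sup>2 + 2 * k * l * C = 1"
    using hyp_lift_norm[of x] unfolding x
    by (simp add: lorentz_simps lorentz_hyp_lift C_def dist_commute power2_eq_square algebra_simps)
  have s: "(sinh (dist p q))\<^sup>2 = C\<^sup>2 - 1" by (simp add: C_def cosh_square_eq)
  have "(sinh (dist p x))\<^sup>2 = (l * sinh (dist p q))\<^sup>2"
    using one unfolding power_mult_distrib sinh_square_eq px C_def[symmetric] by algebra
  then have 1: "sinh (dist p x) = l * sinh (dist p q)" using kl by (simp add: power2_eq_iff_nonneg)
  have "(sinh (dist x q))\<^sup>2 = (k * sinh (dist p q))\<^sup>2"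
    using one unfolding power_mult_distrib sinh_square_eq xq C_def[symmetric] by algebra
  then have 2: "sinh (dist x q) = k * sinh (dist p q)" using kl by (simp add: power2_eq_iff_nonneg)
  have "cosh (dist p x + dist x q) = C"
    using one s unfolding cosh_add px xq 1 2 by algebra
  then show ?thesis by (simp add: geo_segment_def C_def)
qed

text \<open>Cramer's rule gives a linear dependence of the four vectors with alternating signs. Its two sides
are the same vector \<open>w\<close> in the cones over the two diagonals, and \<open>w\<close> projects to a common point.\<close>

lemma hyp_diagonals_meet:
  assumes pos: "0 < volume (hyp_lift a) (hyp_lift b) (hyp_lift c)"
    "0 < volume (hyp_lift a) (hyp_lift b) (hyp_lift d)"
    "0 < volume (hyp_lift a) (hyp_lift c) (hyp_lift d)"
    "0 < volume (hyp_lift b) (hyp_lift c) (hyp_lift d)"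
  shows "geo_segment a c \<inter> geo_segment b d \<noteq> {}"
proof -
  let ?L = hyp_lift
  define w where "w = volume (?L b) (?L c) (?L d) *\<^sub>R ?L a + volume (?L a) (?L b) (?L d) *\<^sub>R ?L c"
  have w: "w = volume (?L a) (?L c) (?L d) *\<^sub>R ?L b + volume (?L a) (?L b) (?L c) *\<^sub>R ?L d"
    unfolding w_def vec3_eq_iff by (simp add: volume_def; safe; algebra)
  have ww: "0 < lorentz (k *\<^sub>R ?L p + l *\<^sub>R ?L q) (k *\<^sub>R ?L p + l *\<^sub>R ?L q)" if "0 < k" "0 < l" for k l p q
  proof -
    have "0 < k * k + k * (l * cosh (dist p q)) + (l * (k * cosh (dist q p)) + l * l)"
      using that by (intro add_pos_pos mult_pos_pos cosh_real_pos)
    then show ?thesis by (simp add: lorentz_simps lorentz_hyp_lift algebra_simps)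
  qed
  define N where "N = lorentz w w"
  have N: "0 < N" unfolding N_def w_def by (rule ww[OF pos(4,2)])
  define k where "k = inverse (sqrt N)"
  have k: "0 < k" "k * (k * N) = 1"
    using N by (auto simp: k_def field_simps)
  have "0 < fst w" unfolding w_def using pos(4,2) fst_hyp_lift_pos[of a] fst_hyp_lift_pos[of c]
    by (simp add: add_pos_pos)
  then obtain z where z: "hyp_lift z = k *\<^sub>R w"
    using k hyp_lift_surj[of "k *\<^sub>R w"] by (auto simp: lorentz_simps N_def)
  have "z \<in> geo_segment a c"
  proof (rule geo_segment_hyp_lift)
    show "hyp_lift z = (k * volume (?L b) (?L c) (?L d)) *\<^sub>R ?L a + (k * volume (?L a) (?L b) (?L d)) *\<^sub>R ?L c"
      unfolding z w_def by (simp add: scaleR_add_right)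
  qed (use k pos in auto)
  moreover have "z \<in> geo_segment b d"
  proof (rule geo_segment_hyp_lift)
    show "hyp_lift z = (k * volume (?L a) (?L c) (?L d)) *\<^sub>R ?L b + (k * volume (?L a) (?L b) (?L c)) *\<^sub>R ?L d"
      unfolding z w by (simp add: scaleR_add_right)
  qed (use k pos in auto)
  ultimately show ?thesis by blast
qed

lemma hyp_three_distances:
  assumes "volume (hyp_lift a) (hyp_lift b) (hyp_lift c) \<noteq> 0"
    and "dist x a = dist y a" "dist x b = dist y b" "dist x c = dist y c"
  shows "x = y"
proof -
  have "hyp_lift x - hyp_lift y = 0"
    by (rule lorentz_nondegenerate[OF assms(1)]) (simp_all add: lorentz_simps lorentz_hyp_lift assms)
  then show ?thesis by (simp add: hyp_lift_inject)
qed

text \<open>The linear map \<open>F\<close> that carries the three vectors to their images preserves the form because it preserves their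
Gram matrix, and preserves the sheet by \<open>future_cone\<close>; so it induces a map of the plane.\<close>

lemma hyp_three_point_extension:
  assumes nz: "volume (hyp_lift a) (hyp_lift b) (hyp_lift c) \<noteq> 0"
    and d: "dist a' b' = dist a b" "dist a' c' = dist a c" "dist b' c' = dist b c"
  shows "\<exists>f. f a = a' \<and> f b = b' \<and> f c = c' \<and> (\<forall>x y :: hyp_plane. dist (f x) (f y :: hyp_plane) = dist x y)"
proof -
  let ?L = hyp_lift
  define V where "V = volume (?L a) (?L b) (?L c)"
  define \<alpha> \<beta> \<gamma> where "\<alpha> v = volume v (?L b) (?L c) / V" and "\<beta> v = volume (?L a) v (?L c) / V"
    and "\<gamma> v = volume (?L a) (?L b) v / V" for v
  have v: "v = \<alpha> v *\<^sub>R ?L a + \<beta> v *\<^sub>R ?L b + \<gamma> v *\<^sub>R ?L c" for v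
  proof -
    have "inverse V *\<^sub>R (V *\<^sub>R v) = \<alpha> v *\<^sub>R ?L a + \<beta> v *\<^sub>R ?L b + \<gamma> v *\<^sub>R ?L c"
      unfolding cramer[of "?L a" "?L b" "?L c" v, folded V_def]
      by (simp add: scaleR_add_right \<alpha>_def \<beta>_def \<gamma>_def divide_inverse mult.commute)
    then show ?thesis using nz by (simp add: V_def)
  qed
  define comb where "comb a b c v = \<alpha> v *\<^sub>R ?L a + \<beta> v *\<^sub>R ?L b + \<gamma> v *\<^sub>R ?L c" for a b c v
  have expand: "lorentz (comb a b c u) (comb a b c v) =
      \<alpha> u * \<alpha> v + \<beta> u * \<beta> v + \<gamma> u * \<gamma> v + (\<alpha> u * \<beta> v + \<beta> u * \<alpha> v) * cosh (dist a b)
      + (\<alpha> u * \<gamma> v + \<gamma> u * \<alpha> v) * cosh (dist a c) + (\<beta> u * \<gamma> v + \<gamma> u * \<beta> v) * cosh (dist b c)" for a b c u v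
    unfolding comb_def lorentz_simps lorentz_hyp_lift dist_commute[of b a] dist_commute[of c a] dist_commute[of c b]
    by (simp add: algebra_simps)
  define F where "F = comb a' b' c'"
  have F: "lorentz (F u) (F v) = lorentz u v" for u v
  proof -
    have "lorentz (F u) (F v) = lorentz (comb a b c u) (comb a b c v)"
      unfolding F_def expand d ..
    moreover have "comb a b c u = u" "comb a b c v = v" unfolding comb_def by (rule v[symmetric])+
    ultimately show ?thesis by simp
  qed
  have abc: "F (?L a) = ?L a'" "F (?L b) = ?L b'" "F (?L c) = ?L c'"
  proof -
    have "volume (?L b) (?L b) (?L c) = 0" "volume (?L a) (?L a) (?L c) = 0" "volume (?L a) (?L b) (?L a) = 0"
      "volume (?L c) (?L b) (?L c) = 0" "volume (?L a) (?L c) (?L c) = 0" "volume (?L a) (?L b) (?L b) = 0"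
      by (simp_all add: volume_def algebra_simps)
    then show "F (?L a) = ?L a'" "F (?L b) = ?L b'" "F (?L c) = ?L c'"
      using nz by (simp_all add: F_def comb_def \<alpha>_def \<beta>_def \<gamma>_def V_def)
  qed
  have "\<exists>q. ?L q = F (?L p)" for p
  proof -
    have "lorentz (F (?L p)) (?L a') = cosh (dist p a)"
      using F[of "?L p" "?L a"] by (simp add: abc lorentz_hyp_lift)
    then have "0 < fst (F (?L p))" by (intro future_cone[of _ a']) (simp_all add: F hyp_lift_norm)
    moreover have "lorentz (F (?L p)) (F (?L p)) = 1" by (simp add: F hyp_lift_norm)
    ultimately show ?thesis using hyp_lift_surj by blast
  qed
  then obtain f where f: "\<And>p. ?L (f p) = F (?L p)" by metis
  have "dist (f x) (f y) = dist x y" for x y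
  proof -
    have "cosh (dist (f x) (f y)) = cosh (dist x y)" unfolding lorentz_hyp_lift[symmetric] f F ..
    then show ?thesis by simp
  qed
  moreover have "f a = a'" "f b = b'" "f c = c'"
    unfolding hyp_lift_inject[symmetric] f abc by (rule refl)+
  ultimately show ?thesis by blast
qed

interpretation hyp: oriented_plane "\<lambda>a b c. volume (hyp_lift a) (hyp_lift b) (hyp_lift c)"
proof
  fix a b c :: hyp_plane
  show "volume (hyp_lift b) (hyp_lift a) (hyp_lift c) = - volume (hyp_lift a) (hyp_lift b) (hyp_lift c)"
    "volume (hyp_lift a) (hyp_lift c) (hyp_lift b) = - volume (hyp_lift a) (hyp_lift b) (hyp_lift c)"
    by (simp_all add: volume_def algebra_simps)
qed (fact hyp_diagonals_meet hyp_three_distances hyp_three_point_extension)+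

section \<open>Circles, horocycles and hypercycles\<close>

definition lorentz_frame :: "vec3 \<Rightarrow> vec3 \<Rightarrow> vec3 \<Rightarrow> bool" where
  "lorentz_frame e0 e1 e2 \<longleftrightarrow>
     lorentz e0 e0 = 1 \<and> lorentz e1 e1 = -1 \<and> lorentz e2 e2 = -1 \<and>
     lorentz e0 e1 = 0 \<and> lorentz e0 e2 = 0 \<and> lorentz e1 e2 = 0"

lemma lorentz_frame_volume:
  assumes "lorentz_frame e0 e1 e2" shows "(volume e0 e1 e2)\<^sup>2 = 1"
  using assms unfolding volume_power2_gram by (simp add: lorentz_frame_def)

lemma lorentz_frame_expansion:
  assumes "lorentz_frame e0 e1 e2"
  shows "v = lorentz v e0 *\<^sub>R e0 - lorentz v e1 *\<^sub>R e1 - lorentz v e2 *\<^sub>R e2"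
proof -
  note e = assms[unfolded lorentz_frame_def]
  have "v - (lorentz v e0 *\<^sub>R e0 - lorentz v e1 *\<^sub>R e1 - lorentz v e2 *\<^sub>R e2) = 0"
  proof (rule lorentz_nondegenerate)
    show "volume e0 e1 e2 \<noteq> 0" using lorentz_frame_volume[OF assms] by auto
  qed (use e lorentz_commute in \<open>simp_all add: lorentz_simps lorentz_commute[of e1 e0]
      lorentz_commute[of e2 e0] lorentz_commute[of e2 e1]\<close>)
  then show ?thesis by simp
qed

lemma lorentz_frame_norm:
  assumes "lorentz_frame e0 e1 e2"
  shows "lorentz v w = lorentz v e0 * lorentz w e0 - lorentz v e1 * lorentz w e1 - lorentz v e2 * lorentz w e2"
proof -
  have "lorentz v w = lorentz v (lorentz w e0 *\<^sub>R e0 - lorentz w e1 *\<^sub>R e1 - lorentz w e2 *\<^sub>R e2)"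
    using lorentz_frame_expansion[OF assms, of w] by simp
  then show ?thesis by (simp add: lorentz_simps)
qed

lemma volume_linear_combination:
  "volume (x *\<^sub>R e0 + y *\<^sub>R e1 + z *\<^sub>R e2) (x' *\<^sub>R e0 + y' *\<^sub>R e1 + z' *\<^sub>R e2) (x'' *\<^sub>R e0 + y'' *\<^sub>R e1 + z'' *\<^sub>R e2)
    = volume (x, y, z) (x', y', z') (x'', y'', z'') * volume e0 e1 e2"
  unfolding volume_def by (simp add: algebra_simps)

text \<open>The third vector is the Lorentzian cross product of the first two.\<close>

lemma lorentz_frame_extend2:
  assumes "lorentz e0 e0 = 1" "lorentz e1 e1 = -1" "lorentz e0 e1 = 0"
  obtains e2 where "lorentz_frame e0 e1 e2"
proof -
  obtain T X Y t x y where e: "e0 = (T, X, Y)" "e1 = (t, x, y)" by (metis prod_cases3)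
  define e2 where "e2 = (X * y - Y * x, T * y - Y * t, X * t - T * x)"
  have h: "T * T - X * X - Y * Y = 1" "t * t - x * x - y * y = - 1" "T * t - X * x - Y * y = 0"
    using assms by (auto simp: e lorentz_def)
  have "lorentz e0 e2 = 0" "lorentz e1 e2 = 0" by (simp_all add: e e2_def lorentz_def algebra_simps)
  moreover have "lorentz e2 e2 = -1"
    using h unfolding e2_def lorentz_def fst_conv snd_conv by algebra
  ultimately have "lorentz_frame e0 e1 e2" using assms by (simp add: lorentz_frame_def)
  then show ?thesis by (rule that)
qed

lemma lorentz_frame_extend1:
  assumes "lorentz e0 e0 = 1"
  obtains e1 e2 where "lorentz_frame e0 e1 e2"
proof -
  obtain T X Y where e: "e0 = (T, X, Y)" by (metis prod_cases3)
  have n: "T * T - X * X - Y * Y = 1" using assms by (simp add: e lorentz_def)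
  define d where "d = T * T - Y * Y"
  have d: "0 < d" using n zero_le_square[of X] unfolding d_def by linarith
  define e1 where "e1 = (1 / sqrt d) *\<^sub>R (Y, 0 :: real, T)"
  have "lorentz e0 e1 = 0" by (simp add: e e1_def lorentz_def)
  moreover have "lorentz e1 e1 = -1"
  proof -
    have "lorentz e1 e1 = (1 / sqrt d) * ((1 / sqrt d) * lorentz (Y, 0, T) (Y, 0, T))"
      unfolding e1_def lorentz_simps ..
    also have "lorentz (Y, 0, T) (Y, 0, T) = - d" by (simp add: lorentz_def d_def)
    finally show ?thesis using d by (simp add: field_simps)
  qed
  ultimately show ?thesis using lorentz_frame_extend2[OF assms] that by metis
qed

text \<open>Since \<open>2 * w\<close> is the Lorentzian length of the chord between the lifted points, lifted curves can be
handled like plane conics.\<close>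

lemma sinh_half_dist:
  assumes "lorentz (hyp_lift p) (hyp_lift q) = 1 + 2 * w\<^sup>2" "0 \<le> w"
  shows "sinh (dist p q / 2) = w"
proof -
  have "cosh (2 * (dist p q / 2)) = 1 + 2 * w\<^sup>2" using assms(1) by (simp add: lorentz_hyp_lift)
  then have "(sinh (dist p q / 2))\<^sup>2 = w\<^sup>2" unfolding cosh_double cosh_square_eq by simp
  then show ?thesis using assms(2) by (simp add: power2_eq_iff_nonneg)
qed

lemma hyp_convex_chartI:
  assumes inj: "\<And>p q. p \<in> K \<Longrightarrow> q \<in> K \<Longrightarrow> t p = t q \<Longrightarrow> sinh (dist p q / 2) = 0"
    and pos: "\<And>a b c. a \<in> K \<Longrightarrow> b \<in> K \<Longrightarrow> c \<in> K \<Longrightarrow> t a < t b \<Longrightarrow> t b < t c \<Longrightarrow>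
      0 < \<sigma> * volume (hyp_lift a) (hyp_lift b) (hyp_lift c)"
  shows "hyp.convex_chart K t"
  unfolding hyp.convex_chart_def
proof (intro conjI exI[of _ \<sigma>] ballI impI)
  show "inj_on t K" using inj by (intro inj_onI) fastforce
qed (use pos in blast)

text \<open>In a frame that starts with the centre, the lifted circle is an ordinary circle of radius \<open>R = sinh r\<close> in the plane
\<open>cosh r *\<^sub>R e0 + span {e1, e2}\<close>.\<close>

lemma hyp_circle_chart:
  assumes "hyp_circle K"
  obtains t R where "hyp.convex_chart K t" "0 < R" "\<And>p. p \<in> K \<Longrightarrow> 0 \<le> t p \<and> t p < pi"
    "\<And>p q. p \<in> K \<Longrightarrow> q \<in> K \<Longrightarrow> sinh (dist p q / 2) = R * \<bar>sin (t p - t q)\<bar>"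
proof -
  obtain m r where r: "0 < r" and K: "K = sphere m r" using assms by (auto simp: hyp_circle_def)
  obtain e1 e2 where frame: "lorentz_frame (hyp_lift m) e1 e2"
    using lorentz_frame_extend1[OF hyp_lift_norm] by blast
  define V where "V = volume (hyp_lift m) e1 e2"
  have V: "V * V = 1" using lorentz_frame_volume[OF frame] by (simp add: V_def power2_eq_square)
  define R where "R = sinh r"
  have R: "0 < R" using r by (simp add: R_def)
  have "\<exists>t. 0 \<le> t \<and> t < pi \<and>
      - lorentz (hyp_lift p) e1 = R * cos (2 * t) \<and> - lorentz (hyp_lift p) e2 = R * sin (2 * t)"
    if "p \<in> K" for p
  proof -
    have "lorentz (hyp_lift p) (hyp_lift m) = cosh r" using that by (simp add: K lorentz_hyp_lift dist_commute)
    then have "(- lorentz (hyp_lift p) e1)\<^sup>2 + (- lorentz (hyp_lift p) e2)\<^sup>2 = R\<^sup>2"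
      using lorentz_frame_norm[OF frame, of "hyp_lift p" "hyp_lift p"] hyp_lift_norm[of p]
      unfolding power2_minus R_def sinh_square_eq by (simp add: power2_eq_square)
    then show ?thesis using polar_double_angle[OF _ R] by metis
  qed
  then obtain t where t: "\<And>p. p \<in> K \<Longrightarrow> 0 \<le> t p \<and> t p < pi"
    and e: "\<And>p. p \<in> K \<Longrightarrow> - lorentz (hyp_lift p) e1 = R * cos (2 * t p)"
      "\<And>p. p \<in> K \<Longrightarrow> - lorentz (hyp_lift p) e2 = R * sin (2 * t p)"
    by metis
  have e0: "lorentz (hyp_lift p) (hyp_lift m) = cosh r" if "p \<in> K" for p
    using that by (simp add: K lorentz_hyp_lift dist_commute)
  have lift: "hyp_lift p = cosh r *\<^sub>R hyp_lift m + (R * cos (2 * t p)) *\<^sub>R e1 + (R * sin (2 * t p)) *\<^sub>R e2"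
    if "p \<in> K" for p
    using lorentz_frame_expansion[OF frame, of "hyp_lift p"] e(1)[OF that] e(2)[OF that] e0[OF that]
    by (metis (no_types, lifting) diff_conv_add_uminus scaleR_minus_left)
  have chord: "sinh (dist p q / 2) = R * \<bar>sin (t p - t q)\<bar>" if "p \<in> K" "q \<in> K" for p q
  proof (rule sinh_half_dist)
    have "lorentz (hyp_lift p) (hyp_lift q) =
      cosh r * cosh r - (R * cos (2 * t p)) * (R * cos (2 * t q)) - (R * sin (2 * t p)) * (R * sin (2 * t q))"
      unfolding lorentz_frame_norm[OF frame, of "hyp_lift p" "hyp_lift q"] e0[OF that(1)] e0[OF that(2)]
        e(1)[OF that(1), symmetric] e(1)[OF that(2), symmetric] e(2)[OF that(1), symmetric] e(2)[OF that(2), symmetric]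
      by simp
    also have "\<dots> = (cosh r)\<^sup>2 - R\<^sup>2 * cos (2 * (t p - t q))"
      by (simp add: cos_diff right_diff_distrib power2_eq_square algebra_simps)
    also have "\<dots> = 1 + 2 * (R * \<bar>sin (t p - t q)\<bar>)\<^sup>2"
      unfolding cos_double_sin cosh_square_eq R_def power_mult_distrib power2_abs by (simp add: algebra_simps)
    finally show "lorentz (hyp_lift p) (hyp_lift q) = 1 + 2 * (R * \<bar>sin (t p - t q)\<bar>)\<^sup>2" .
  qed (use R in simp)
  have "hyp.convex_chart K t"
  proof (rule hyp_convex_chartI[where \<sigma> = V])
    fix a b c assume abc: "a \<in> K" "b \<in> K" "c \<in> K" "t a < t b" "t b < t c"
    have "volume (hyp_lift a) (hyp_lift b) (hyp_lift c) = cosh r * R\<^sup>2 *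
       ((cos (2 * t b) - cos (2 * t a)) * (sin (2 * t c) - sin (2 * t a)) -
        (sin (2 * t b) - sin (2 * t a)) * (cos (2 * t c) - cos (2 * t a))) * V"
      unfolding lift[OF abc(1)] lift[OF abc(2)] lift[OF abc(3)] volume_linear_combination V_def[symmetric]
      by (simp add: volume_def power2_eq_square algebra_simps)
    also have "V * \<dots> = cosh r * R\<^sup>2 * (4 * sin (t b - t a) * sin (t c - t b) * sin (t c - t a)) * (V * V)"
      unfolding circle_determinant by (simp only: mult_ac)
    finally have "V * volume (hyp_lift a) (hyp_lift b) (hyp_lift c) =
      cosh r * R\<^sup>2 * (4 * sin (t b - t a) * sin (t c - t b) * sin (t c - t a))" unfolding V by simp
    moreover have "0 < sin (t b - t a)" "0 < sin (t c - t b)" "0 < sin (t c - t a)"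
      using abc t[OF abc(1)] t[OF abc(3)] by (auto intro!: sin_gt_zero)
    ultimately show "0 < V * volume (hyp_lift a) (hyp_lift b) (hyp_lift c)"
      using R by simp
  qed (simp add: chord)
  then show ?thesis using that R t chord by blast
qed

text \<open>A lifted horocycle is a parabola, whose points have Vandermonde determinants as volumes. For a horocycle
based at the ideal point \<open>a\<close>, the parameter is the horizontal coordinate after an inversion in \<open>a\<close>, up to scaling and sign.\<close>

lemma horocycle_chart:
  assumes "horocycle K"
  obtains t where "hyp.convex_chart K t"
    "\<And>p q. p \<in> K \<Longrightarrow> q \<in> K \<Longrightarrow> sinh (dist p q / 2) = \<bar>t p - t q\<bar>"
proof -
  have half: "sinh (dist p q / 2) = w"
    if "(cmod (hp_coord p - hp_coord q))\<^sup>2 = 4 * Im (hp_coord p) * Im (hp_coord q) * w\<^sup>2" "0 \<le> w" for p q w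
  proof -
    have "cosh (dist p q) = hyp_cosh_dist (hp_coord p) (hp_coord q)"
      using hyp_cosh_dist_ge_1[OF Im_hp_coord_pos[of p] Im_hp_coord_pos[of q]] by (simp add: dist_hyp_plane_def)
    then have "lorentz (hyp_lift p) (hyp_lift q) = 1 + 2 * w\<^sup>2"
      unfolding lorentz_hyp_lift hyp_cosh_dist_def that(1)
      using Im_hp_coord_pos[of p] Im_hp_coord_pos[of q] by simp
    then show ?thesis using that(2) by (rule sinh_half_dist)
  qed
  consider h where "0 < h" "K = {p. Im (hp_coord p) = h}"
    | a r where "0 < r" "K = {p. dist (hp_coord p) (Complex a r) = r}"
    using assms by (auto simp: horocycle_def)
  then show ?thesis
  proof cases
    case 1
    define t where "t p = Re (hp_coord p) / (2 * h)" for p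
    have chord: "sinh (dist p q / 2) = \<bar>t p - t q\<bar>" if "p \<in> K" "q \<in> K" for p q
    proof (rule half)
      show "(cmod (hp_coord p - hp_coord q))\<^sup>2 = 4 * Im (hp_coord p) * Im (hp_coord q) * \<bar>t p - t q\<bar>\<^sup>2"
        using that 1 unfolding cmod_power2 power2_abs
        by (simp add: t_def diff_divide_distrib[symmetric] power_divide power2_eq_square)
    qed simp
    have lift: "hyp_lift p = (1 / h) *\<^sub>R ((1 + (2 * h * t p)\<^sup>2 + h\<^sup>2) / 2, ((2 * h * t p)\<^sup>2 + h\<^sup>2 - 1) / 2, 2 * h * t p)"
      if "p \<in> K" for p
      using that 1 unfolding hyp_lift_def cmod_power2 by (simp add: t_def add.assoc)
    have "hyp.convex_chart K t"
    proof (rule hyp_convex_chartI[where \<sigma> = "-1"])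
      fix a b c assume abc: "a \<in> K" "b \<in> K" "c \<in> K" "t a < t b" "t b < t c"
      have "-1 * volume (hyp_lift a) (hyp_lift b) (hyp_lift c) = 4 * ((t b - t a) * (t c - t b) * (t c - t a))"
        unfolding lift[OF abc(1)] lift[OF abc(2)] lift[OF abc(3)] volume_def using 1(1)
        by (simp add: divide_simps) algebra
      then show "0 < -1 * volume (hyp_lift a) (hyp_lift b) (hyp_lift c)" using abc by simp
    qed (simp add: chord)
    then show ?thesis using that chord by blast
  next
    case 2
    define t where "t p = (Re (hp_coord p) - a) / (2 * Im (hp_coord p))" for p
    have coords: "Re (hp_coord p) = a + 2 * Im (hp_coord p) * t p"
      "Im (hp_coord p) * (1 + 4 * (t p)\<^sup>2) = 2 * r" if "p \<in> K" for p
    proof -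
      have y: "0 < Im (hp_coord p)" by (rule Im_hp_coord_pos)
      show x: "Re (hp_coord p) = a + 2 * Im (hp_coord p) * t p" using y by (simp add: t_def)
      have "(dist (hp_coord p) (Complex a r))\<^sup>2 = r\<^sup>2" using that 2 by simp
      then have "(Re (hp_coord p) - a)\<^sup>2 + (Im (hp_coord p) - r)\<^sup>2 = r\<^sup>2"
        unfolding dist_norm cmod_power2 by simp
      then have "Im (hp_coord p) * (Im (hp_coord p) * (1 + 4 * (t p)\<^sup>2)) = Im (hp_coord p) * (2 * r)"
        unfolding x by algebra
      then show "Im (hp_coord p) * (1 + 4 * (t p)\<^sup>2) = 2 * r" using y by simp
    qed
    have Im: "Im (hp_coord p) = 2 * r / (1 + 4 * (t p)\<^sup>2)" if "p \<in> K" for p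
    proof -
      have "1 + 4 * (t p)\<^sup>2 \<noteq> 0" using zero_le_power2[of "t p"] by linarith
      then show ?thesis using coords(2)[OF that] by (simp add: field_simps)
    qed
    have chord: "sinh (dist p q / 2) = \<bar>t p - t q\<bar>" if "p \<in> K" "q \<in> K" for p q
    proof (rule half)
      have alg: "(y * s - z * u)\<^sup>2 * 4 + (y - z)\<^sup>2 = 4 * y * z * (s - u)\<^sup>2"
        if "y * (1 + 4 * s\<^sup>2) = R" "z * (1 + 4 * u\<^sup>2) = R" for y z s u R :: real
      proof -
        have "(y * s - z * u)\<^sup>2 * 4 + (y - z)\<^sup>2 = y * (y * (1 + 4 * s\<^sup>2)) + z * (z * (1 + 4 * u\<^sup>2)) - 8 * y * z * s * u - 2 * y * z"
          by algebra
        also have "\<dots> = z * (y * (1 + 4 * s\<^sup>2)) + y * (z * (1 + 4 * u\<^sup>2)) - 8 * y * z * s * u - 2 * y * z"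
          unfolding that by simp
        also have "\<dots> = 4 * y * z * (s - u)\<^sup>2" by algebra
        finally show ?thesis .
      qed
      have "(cmod (hp_coord p - hp_coord q))\<^sup>2 =
        (Im (hp_coord p) * t p - Im (hp_coord q) * t q)\<^sup>2 * 4 + (Im (hp_coord p) - Im (hp_coord q))\<^sup>2"
        unfolding cmod_power2 minus_complex.sel coords(1)[OF that(1)] coords(1)[OF that(2)] by algebra
      then show "(cmod (hp_coord p - hp_coord q))\<^sup>2 = 4 * Im (hp_coord p) * Im (hp_coord q) * \<bar>t p - t q\<bar>\<^sup>2"
        unfolding power2_abs alg[OF coords(2)[OF that(1)] coords(2)[OF that(2)]] .
    qed simp
    have lift: "hyp_lift p = (1 / (2 * r)) *\<^sub>R
        (((1 + a\<^sup>2) * (1 + 4 * (t p)\<^sup>2) + 8 * a * r * t p + 4 * r\<^sup>2) / 2,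
         ((a\<^sup>2 - 1) * (1 + 4 * (t p)\<^sup>2) + 8 * a * r * t p + 4 * r\<^sup>2) / 2,
         a * (1 + 4 * (t p)\<^sup>2) + 4 * r * t p)"
      if "p \<in> K" for p
    proof -
      define Q where "Q = 1 + 4 * (t p)\<^sup>2"
      have Q: "0 < Q" using zero_le_power2[of "t p"] unfolding Q_def by linarith
      have y: "Im (hp_coord p) = 2 * r / Q" using Im[OF that] by (simp add: Q_def)
      have x: "Re (hp_coord p) = a + 4 * r * t p / Q" using coords(1)[OF that] by (simp add: y)
      have n: "(cmod (hp_coord p))\<^sup>2 = (a\<^sup>2 * Q + 8 * a * r * t p + 4 * r\<^sup>2) / Q"
      proof -
        have "(cmod (hp_coord p))\<^sup>2 = (a + 4 * r * t p / Q)\<^sup>2 + (2 * r / Q)\<^sup>2" unfolding cmod_power2 x y ..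
        also have "\<dots> = a\<^sup>2 + 8 * a * r * t p / Q + 4 * r\<^sup>2 * (4 * (t p)\<^sup>2 + 1) / Q\<^sup>2"
          using Q by (simp add: field_simps power2_eq_square)
        also have "4 * r\<^sup>2 * (4 * (t p)\<^sup>2 + 1) / Q\<^sup>2 = 4 * r\<^sup>2 / Q"
          using Q by (simp add: Q_def power2_eq_square add.commute)
        finally show ?thesis using Q by (simp add: add_divide_distrib)
      qed
      show ?thesis unfolding hyp_lift_def n y x Q_def[symmetric] using Q 2(1)
        by (simp add: field_simps)
    qed
    have "hyp.convex_chart K t"
    proof (rule hyp_convex_chartI[where \<sigma> = "1"])
      fix p q s assume pqs: "p \<in> K" "q \<in> K" "s \<in> K" "t p < t q" "t q < t s"
      have "1 * volume (hyp_lift p) (hyp_lift q) (hyp_lift s) = 4 * ((t q - t p) * (t s - t q) * (t s - t p))"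
        unfolding lift[OF pqs(1)] lift[OF pqs(2)] lift[OF pqs(3)] volume_def using 2(1)
        by (simp add: divide_simps) algebra
      then show "0 < 1 * volume (hyp_lift p) (hyp_lift q) (hyp_lift s)" using pqs by simp
    qed (simp add: chord)
    then show ?thesis using that chord by blast
  qed
qed

text \<open>A unit speed geodesic is reconstructed from its points at the times 0 and 1: they give \<open>e0\<close> and \<open>e1\<close>, the distances to
these two points give the components along \<open>e0\<close> and \<open>e1\<close>, and then \<open>lorentz v v = 1\<close> leaves no component along \<open>e2\<close>.\<close>

lemma hyp_geodesic_lift:
  assumes "hyp_geodesic L"
  obtains \<gamma> e0 e1 e2 where "L = range \<gamma>" "lorentz_frame e0 e1 e2"
    "\<And>s. hyp_lift (\<gamma> s) = cosh s *\<^sub>R e0 + sinh s *\<^sub>R e1"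
proof -
  obtain \<gamma> :: "real \<Rightarrow> hyp_plane" where d: "\<And>s t. dist (\<gamma> s) (\<gamma> t) = \<bar>s - t\<bar>" and L: "L = range \<gamma>"
    using assms by (auto simp: hyp_geodesic_def)
  have B: "lorentz (hyp_lift (\<gamma> s)) (hyp_lift (\<gamma> t)) = cosh (s - t)" for s t
    by (simp add: lorentz_hyp_lift d)
  define S where "S = sinh (1 :: real)"
  have S: "0 < S" "(cosh 1)\<^sup>2 = S\<^sup>2 + (1 :: real)" by (simp_all add: S_def cosh_square_eq)
  define e0 e1 where "e0 = hyp_lift (\<gamma> 0)" and "e1 = (1 / S) *\<^sub>R (hyp_lift (\<gamma> 1) - cosh 1 *\<^sub>R e0)"
  have e0: "lorentz (hyp_lift (\<gamma> s)) e0 = cosh s" for s by (simp add: e0_def B)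
  have e1: "lorentz (hyp_lift (\<gamma> s)) e1 = - sinh s" for s
  proof -
    have "cosh (s - 1) - cosh 1 * cosh s = - S * sinh s" by (simp add: cosh_diff S_def)
    then show ?thesis using S by (simp add: e1_def lorentz_simps e0 B field_simps)
  qed
  have norms: "lorentz e0 e0 = 1" "lorentz e0 e1 = 0" using e0[of 0] e1[of 0] by (simp_all add: e0_def)
  have "lorentz e1 e1 = (1 / S) * (- sinh 1)"
    unfolding e1_def[THEN arg_cong[where f = "\<lambda>u. lorentz u e1"]] lorentz_simps e1 norms by simp
  then have "lorentz e1 e1 = -1" using S by (simp add: S_def)
  then obtain e2 where frame: "lorentz_frame e0 e1 e2"
    using lorentz_frame_extend2 norms by metis
  have "hyp_lift (\<gamma> s) = cosh s *\<^sub>R e0 + sinh s *\<^sub>R e1" for s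
  proof -
    let ?v = "hyp_lift (\<gamma> s)"
    have "1 = cosh s * cosh s - sinh s * sinh s - lorentz ?v e2 * lorentz ?v e2"
      using lorentz_frame_norm[OF frame, of ?v ?v] by (simp add: hyp_lift_norm e0 e1)
    then have "lorentz ?v e2 = 0" using hyperbolic_pythagoras[of s] by (simp add: power2_eq_square)
    then show ?thesis using lorentz_frame_expansion[OF frame, of ?v] by (simp add: e0 e1)
  qed
  then show ?thesis using that L frame by blast
qed

text \<open>The component along \<open>e2\<close>, the normal vector of the geodesic, is the hyperbolic sine of the signed distance.
The parameter \<open>u\<close> belongs to the foot of the perpendicular, where the distance is attained.\<close>

lemma hyp_equidistant_coordinates:
  fixes p :: hyp_plane
  assumes frame: "lorentz_frame e0 e1 e2"
    and \<gamma>: "\<And>s. hyp_lift (\<gamma> s) = cosh s *\<^sub>R e0 + sinh s *\<^sub>R e1"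
  defines "c \<equiv> cosh (infdist p (range \<gamma>))"
  shows "c\<^sup>2 = 1 + (lorentz (hyp_lift p) e2)\<^sup>2"
    and "\<exists>u. hyp_lift p = (c * cosh u) *\<^sub>R e0 + (c * sinh u) *\<^sub>R e1 - lorentz (hyp_lift p) e2 *\<^sub>R e2"
proof -
  let ?v = "hyp_lift p"
  define k where "k = sqrt (1 + (lorentz ?v e2)\<^sup>2)"
  have k: "1 \<le> k" "k\<^sup>2 = 1 + (lorentz ?v e2)\<^sup>2" by (simp_all add: k_def)
  define u where "u = arsinh (- lorentz ?v e1 / k)"
  have e1: "lorentz ?v e1 = - k * sinh u" using k by (simp add: u_def)
  have "hyp_lift (\<gamma> 0) = e0" by (simp add: \<gamma>)
  then have "lorentz ?v e0 = cosh (dist p (\<gamma> 0))" using lorentz_hyp_lift[of p "\<gamma> 0"] by simp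
  then have A: "0 \<le> lorentz ?v e0" by simp
  have "(lorentz ?v e0)\<^sup>2 = 1 + (lorentz ?v e2)\<^sup>2 + (lorentz ?v e1)\<^sup>2"
    using lorentz_frame_norm[OF frame, of ?v ?v] by (simp add: hyp_lift_norm power2_eq_square)
  also have "\<dots> = (k * cosh u)\<^sup>2"
    unfolding k(2)[symmetric] e1 by (simp add: power_mult_distrib cosh_square_eq algebra_simps)
  finally have e0: "lorentz ?v e0 = k * cosh u" using A k by (simp add: power2_eq_iff_nonneg)
  have cosh_dist: "cosh (dist p (\<gamma> s)) = k * cosh (s - u)" for s
    unfolding lorentz_hyp_lift[symmetric] \<gamma> lorentz_simps e0 e1 by (simp add: cosh_diff algebra_simps)
  have lower: "dist p (\<gamma> u) \<le> dist p (\<gamma> s)" for s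
  proof -
    have "cosh (dist p (\<gamma> u)) \<le> cosh (dist p (\<gamma> s))"
      unfolding cosh_dist using k mult_left_mono[OF cosh_real_ge_1[of "s - u"], of k] by simp
    then show ?thesis by (metis cosh_real_nonneg_le_iff zero_le_dist)
  qed
  have "infdist p (range \<gamma>) = dist p (\<gamma> u)"
  proof (rule antisym)
    show "infdist p (range \<gamma>) \<le> dist p (\<gamma> u)" by (rule infdist_le) simp
    show "dist p (\<gamma> u) \<le> infdist p (range \<gamma>)"
      unfolding infdist_def using lower by (auto intro!: cINF_greatest)
  qed
  then have c: "c = k" by (simp add: c_def cosh_dist)
  show "c\<^sup>2 = 1 + (lorentz ?v e2)\<^sup>2" using k c by simp
  show "\<exists>u. ?v = (c * cosh u) *\<^sub>R e0 + (c * sinh u) *\<^sub>R e1 - lorentz ?v e2 *\<^sub>R e2"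
    using lorentz_frame_expansion[OF frame, of ?v] unfolding e0 e1 c by (intro exI[of _ u]) simp
qed

text \<open>Any vector is a combination of three vectors on the hyperboloid, for which the product is the hyperbolic
cosine of a distance.\<close>

lemma continuous_on_lorentz_hyp_lift:
  "continuous_on A (\<lambda>p. lorentz (hyp_lift p) v)"
proof -
  have "lorentz (1, 0, 0) (1, 0, 0) = 1" "lorentz (5/4, 3/4, 0) (5/4, 3/4, 0) = 1"
    "lorentz (5/4, 0, 3/4) (5/4, 0, 3/4) = 1"
    by (simp_all add: lorentz_def)
  then obtain q0 q1 q2 where q: "hyp_lift q0 = (1, 0, 0)" "hyp_lift q1 = (5/4, 3/4, 0)" "hyp_lift q2 = (5/4, 0, 3/4)"
    using hyp_lift_surj by (metis fst_conv zero_less_divide_iff zero_less_numeral zero_less_one)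
  have v: "v = (fst v - 5/3 * fst (snd v) - 5/3 * snd (snd v)) *\<^sub>R hyp_lift q0
    + (4/3 * fst (snd v)) *\<^sub>R hyp_lift q1 + (4/3 * snd (snd v)) *\<^sub>R hyp_lift q2"
    unfolding vec3_eq_iff q by simp
  have "continuous_on A (\<lambda>p. lorentz (hyp_lift p) (x *\<^sub>R hyp_lift q0 + y *\<^sub>R hyp_lift q1 + z *\<^sub>R hyp_lift q2))" for x y z
    unfolding lorentz_simps lorentz_hyp_lift by (intro continuous_intros)
  then show ?thesis using v by metis
qed

lemma hyperbola_determinant:
  fixes s t u :: real
  shows "(cosh (2 * t) - cosh (2 * s)) * (sinh (2 * u) - sinh (2 * s)) -
      (sinh (2 * t) - sinh (2 * s)) * (cosh (2 * u) - cosh (2 * s))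
    = - 4 * sinh (t - s) * sinh (u - t) * sinh (u - s)"
proof -
  have c: "cosh (2 * x) - cosh (2 * s) = 2 * sinh (x + s) * sinh (x - s)" for x
  proof -
    have "2 * x = (x + s) + (x - s)" "2 * s = (x + s) - (x - s)" by simp_all
    then show ?thesis by (simp only: cosh_add cosh_diff)
  qed
  have s: "sinh (2 * x) - sinh (2 * s) = 2 * cosh (x + s) * sinh (x - s)" for x
  proof -
    have "2 * x = (x + s) + (x - s)" "2 * s = (x + s) - (x - s)" by simp_all
    then show ?thesis by (simp only: sinh_add sinh_diff)
  qed
  have e: "sinh (u - t) = sinh (u + s) * cosh (t + s) - cosh (u + s) * sinh (t + s)"
    using sinh_diff[of "u + s" "t + s"] by simp
  show ?thesis unfolding c s e by (simp add: algebra_simps)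
qed

text \<open>The points at distance \<open>r\<close> from the geodesic have \<open>height\<close> \<open>sinh r\<close> or \<open>- sinh r\<close>; a connected set of them lies on one
side. The lifted curve is then a branch of a hyperbola in an affine plane, with
\<open>c = cosh r\<close>.\<close>

lemma hypercycle_chart:
  assumes "hypercycle K"
  obtains t c where "hyp.convex_chart K t" "0 < c"
    "\<And>p q. p \<in> K \<Longrightarrow> q \<in> K \<Longrightarrow> sinh (dist p q / 2) = c * sinh \<bar>t p - t q\<bar>"
proof -
  obtain L r where L: "hyp_geodesic L" and r: "0 < r" and comp: "K \<in> components {p. infdist p L = r}"
    using assms by (auto simp: hypercycle_def)
  obtain \<gamma> e0 e1 e2 where \<gamma>: "L = range \<gamma>" and frame: "lorentz_frame e0 e1 e2"
    and lift_\<gamma>: "\<And>s. hyp_lift (\<gamma> s) = cosh s *\<^sub>R e0 + sinh s *\<^sub>R e1"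
    using hyp_geodesic_lift[OF L] by metis
  define height where "height p = lorentz (hyp_lift p) e2" for p
  define c where "c = cosh r"
  have c: "0 < c" by (simp add: c_def)
  have dist_L: "infdist p (range \<gamma>) = r" if "p \<in> K" for p
    using in_components_subset[OF comp] that \<gamma> by auto
  note coords = hyp_equidistant_coordinates[OF frame lift_\<gamma>, folded height_def]
  have c_height: "c\<^sup>2 = 1 + (height p)\<^sup>2" if "p \<in> K" for p
    using coords(1)[of p] dist_L[OF that] by (simp add: c_def)
  have "\<exists>u. hyp_lift p = (c * cosh (2 * u)) *\<^sub>R e0 + (c * sinh (2 * u)) *\<^sub>R e1 - height p *\<^sub>R e2" if p: "p \<in> K" for p
  proof -
    obtain u where "hyp_lift p = (c * cosh u) *\<^sub>R e0 + (c * sinh u) *\<^sub>R e1 - height p *\<^sub>R e2"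
      using coords(2)[of p] dist_L[OF p] by (auto simp: c_def)
    then show ?thesis by (intro exI[of _ "u / 2"]) simp
  qed
  then obtain t where t: "\<And>p. p \<in> K \<Longrightarrow>
      hyp_lift p = (c * cosh (2 * t p)) *\<^sub>R e0 + (c * sinh (2 * t p)) *\<^sub>R e1 - height p *\<^sub>R e2"
    by metis
  have abs_height: "\<bar>height p\<bar> = sinh r" if "p \<in> K" for p
  proof -
    have "\<bar>height p\<bar>\<^sup>2 = (sinh r)\<^sup>2" using c_height[OF that] by (simp add: c_def cosh_square_eq)
    then show ?thesis by (rule power2_eq_imp_eq) (use r in auto)
  qed
  have same_height: "height p = height q" if pq: "p \<in> K" "q \<in> K" for p q
  proof -
    have "connected (height ` K)"
      unfolding height_def using in_components_connected[OF comp]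
      by (intro connected_continuous_image continuous_on_lorentz_hyp_lift)
    then have interval: "z \<in> height ` K" if "p \<in> K" "q \<in> K" "height p \<le> z" "z \<le> height q" for p q z
      using that unfolding connected_iff_interval by blast
    have "0 \<notin> height ` K" using abs_height r by force
    then have "\<not> (height p \<le> 0 \<and> 0 \<le> height q)" "\<not> (height q \<le> 0 \<and> 0 \<le> height p)"
      using interval pq by blast+
    then show ?thesis using abs_height[OF pq(1)] abs_height[OF pq(2)] by linarith
  qed
  have chord: "sinh (dist p q / 2) = c * sinh \<bar>t p - t q\<bar>" if "p \<in> K" "q \<in> K" for p q
  proof (rule sinh_half_dist)
    note fr = frame[unfolded lorentz_frame_def]
    have "lorentz (hyp_lift p) (hyp_lift q) =
      c * cosh (2 * t p) * (c * cosh (2 * t q)) - c * sinh (2 * t p) * (c * sinh (2 * t q)) - height p * height q"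
      unfolding t[OF that(1)] t[OF that(2)] using fr
      by (simp add: lorentz_simps lorentz_commute[of e1 e0] lorentz_commute[of e2 e0] lorentz_commute[of e2 e1])
    also have "height q = height p" by (rule same_height[OF that(2,1)])
    also have "c * cosh (2 * t p) * (c * cosh (2 * t q)) - c * sinh (2 * t p) * (c * sinh (2 * t q)) - height p * height p
      = c\<^sup>2 * cosh (2 * (t p - t q)) - (c\<^sup>2 - 1)"
    proof -
      have h: "height p * height p = c\<^sup>2 - 1" using c_height[OF that(1)] by (simp add: power2_eq_square)
      have "cosh (2 * (t p - t q)) = cosh (2 * t p) * cosh (2 * t q) - sinh (2 * t p) * sinh (2 * t q)"
        unfolding right_diff_distrib by (rule cosh_diff)
      then show ?thesis unfolding h by algebra
    qed
    also have "\<dots> = 1 + 2 * (c * sinh \<bar>t p - t q\<bar>)\<^sup>2"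
      unfolding cosh_double cosh_square_eq by (simp add: power_mult_distrib algebra_simps)
    finally show "lorentz (hyp_lift p) (hyp_lift q) = 1 + 2 * (c * sinh \<bar>t p - t q\<bar>)\<^sup>2" .
  qed (use c in simp)
  define V where "V = volume e0 e1 e2"
  have V: "V * V = 1" using lorentz_frame_volume[OF frame] by (simp add: V_def power2_eq_square)
  obtain h where h: "\<And>p. p \<in> K \<Longrightarrow> height p = h" using same_height by (metis (full_types))
  have "K \<noteq> {}" using in_components_nonempty[OF comp] .
  then have h0: "h \<noteq> 0" using abs_height h r by force
  have lift: "hyp_lift p = (c * cosh (2 * t p)) *\<^sub>R e0 + (c * sinh (2 * t p)) *\<^sub>R e1 + (- h) *\<^sub>R e2" if "p \<in> K" for p
    using t[OF that] h[OF that] by simp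
  have "hyp.convex_chart K t"
  proof (rule hyp_convex_chartI[where \<sigma> = "h * V"])
    fix p q s assume pqs: "p \<in> K" "q \<in> K" "s \<in> K" "t p < t q" "t q < t s"
    have "volume (hyp_lift p) (hyp_lift q) (hyp_lift s) = - h * c\<^sup>2 *
       ((cosh (2 * t q) - cosh (2 * t p)) * (sinh (2 * t s) - sinh (2 * t p)) -
        (sinh (2 * t q) - sinh (2 * t p)) * (cosh (2 * t s) - cosh (2 * t p))) * V"
      unfolding lift[OF pqs(1)] lift[OF pqs(2)] lift[OF pqs(3)] volume_linear_combination V_def[symmetric]
      by (simp add: volume_def power2_eq_square algebra_simps)
    then have "h * V * volume (hyp_lift p) (hyp_lift q) (hyp_lift s) =
      h * h * c\<^sup>2 * (4 * sinh (t q - t p) * sinh (t s - t q) * sinh (t s - t p)) * (V * V)"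
      unfolding hyperbola_determinant by simp
    also have "\<dots> = h\<^sup>2 * c\<^sup>2 * (4 * sinh (t q - t p) * sinh (t s - t q) * sinh (t s - t p))"
      unfolding V power2_eq_square by simp
    also have "0 < \<dots>" using h0 c pqs by (intro mult_pos_pos) auto
    finally show "0 < h * V * volume (hyp_lift p) (hyp_lift q) (hyp_lift s)" .
  qed (simp add: chord)
  then show ?thesis using that c chord by blast
qed

section \<open>Congruence of cyclic polygons\<close>

lemma hyperbolic_cyclic_polygon:
  assumes "simple_polygon P" "hyperbolic_cyclic P"
  defines "S \<equiv> \<lambda>i j. sinh (dist (P ! i) (P ! j) / 2)"
  shows "circular_chords (length P) S \<or> horocyclic_chords (length P) S \<or> hypercyclic_chords (length P) S"
    and "volume (hyp_lift (P ! 0)) (hyp_lift (P ! 1)) (hyp_lift (P ! 2)) \<noteq> 0"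
proof -
  obtain K where K: "hyp_circle K \<or> hypercycle K \<or> horocycle K" and P: "set P \<subseteq> K"
    using assms(2) by (auto simp: hyperbolic_cyclic_def)
  have PK: "P ! i \<in> K" if "i < length P" for i using P that nth_mem by blast
  note orient = hyp.inscribed_polygon_orient_nonzero[OF assms(1) _ P]
  note parameters = hyp.inscribed_polygon_parameters[OF assms(1) _ P]
  from K have "(circular_chords (length P) S \<or> horocyclic_chords (length P) S \<or> hypercyclic_chords (length P) S) \<and>
    volume (hyp_lift (P ! 0)) (hyp_lift (P ! 1)) (hyp_lift (P ! 2)) \<noteq> 0"
  proof (elim disjE)
    assume circle: "hyp_circle K"
    obtain t R where chart: "hyp.convex_chart K t" and R: "0 < R" and t: "\<And>p. p \<in> K \<Longrightarrow> 0 \<le> t p \<and> t p < pi"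
      and chord: "\<And>p q. p \<in> K \<Longrightarrow> q \<in> K \<Longrightarrow> sinh (dist p q / 2) = R * \<bar>sin (t p - t q)\<bar>"
      using hyp_circle_chart[OF circle] by blast
    obtain x J where x: "cyclically_increasing (length P) x J"
      "\<And>i j. \<bar>x i - x j\<bar> = \<bar>t (P ! i) - t (P ! j)\<bar>" "\<And>i j. \<bar>sin (x i - x j)\<bar> = \<bar>sin (t (P ! i) - t (P ! j))\<bar>"
      using parameters[OF chart] by blast
    have "\<bar>x i - x j\<bar> < pi \<and> S i j = R * \<bar>sin (x i - x j)\<bar>" if "i < length P" "j < length P" for i j
      using t[OF PK[OF that(1)]] t[OF PK[OF that(2)]] chord[OF PK[OF that(1)] PK[OF that(2)]] x(2,3)[of i j]
      by (simp add: S_def abs_if split: if_splits)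
    then have "circular_chords (length P) S" unfolding circular_chords_def using x(1) R by blast
    then show ?thesis using orient[OF chart] by blast
  next
    assume horo: "horocycle K"
    obtain t where chart: "hyp.convex_chart K t"
      and chord: "\<And>p q. p \<in> K \<Longrightarrow> q \<in> K \<Longrightarrow> sinh (dist p q / 2) = \<bar>t p - t q\<bar>"
      using horocycle_chart[OF horo] by blast
    obtain x J where x: "cyclically_increasing (length P) x J"
      "\<And>i j. \<bar>x i - x j\<bar> = \<bar>t (P ! i) - t (P ! j)\<bar>" "\<And>i j. \<bar>sin (x i - x j)\<bar> = \<bar>sin (t (P ! i) - t (P ! j))\<bar>"
      using parameters[OF chart] by blast
    have "S i j = \<bar>x i - x j\<bar>" if "i < length P" "j < length P" for i j
      unfolding S_def x(2) by (rule chord[OF PK[OF that(1)] PK[OF that(2)]])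
    then have "horocyclic_chords (length P) S" unfolding horocyclic_chords_def using x(1) by blast
    then show ?thesis using orient[OF chart] by blast
  next
    assume hyper: "hypercycle K"
    obtain t c where chart: "hyp.convex_chart K t" and c: "0 < c"
      and chord: "\<And>p q. p \<in> K \<Longrightarrow> q \<in> K \<Longrightarrow> sinh (dist p q / 2) = c * sinh \<bar>t p - t q\<bar>"
      using hypercycle_chart[OF hyper] by blast
    obtain x J where x: "cyclically_increasing (length P) x J"
      "\<And>i j. \<bar>x i - x j\<bar> = \<bar>t (P ! i) - t (P ! j)\<bar>" "\<And>i j. \<bar>sin (x i - x j)\<bar> = \<bar>sin (t (P ! i) - t (P ! j))\<bar>"
      using parameters[OF chart] by blast
    have "S i j = c * sinh \<bar>x i - x j\<bar>" if "i < length P" "j < length P" for i j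
      unfolding S_def x(2) by (rule chord[OF PK[OF that(1)] PK[OF that(2)]])
    then have "hypercyclic_chords (length P) S" unfolding hypercyclic_chords_def using x(1) c by blast
    then show ?thesis using orient[OF chart] by blast
  qed
  then show "circular_chords (length P) S \<or> horocyclic_chords (length P) S \<or> hypercyclic_chords (length P) S"
    and "volume (hyp_lift (P ! 0)) (hyp_lift (P ! 1)) (hyp_lift (P ! 2)) \<noteq> 0" by blast+
qed

lemma side_length_nth: "length P = n \<Longrightarrow> side_length P i = dist (P ! i) (P ! (Suc i mod n))"
  by (simp add: side_length_def next_vertex_def)

theorem corollary1p8:
  fixes n :: nat
  assumes "n \<ge> 3"
  shows
    "(\<forall>P P' :: (real ^ 2) list.
        length P = n \<and> length P' = n \<and>
        simple_polygon P \<and> simple_polygon P' \<and>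
        euclidean_cyclic P \<and> euclidean_cyclic P' \<and>
        (\<forall>i<n. side_length P i = side_length P' i)
        \<longrightarrow> congruent_polygons P P') \<and>
     (\<forall>P P' :: hyp_plane list.
        length P = n \<and> length P' = n \<and>
        simple_polygon P \<and> simple_polygon P' \<and>
        hyperbolic_cyclic P \<and> hyperbolic_cyclic P' \<and>
        (\<forall>i<n. side_length P i = side_length P' i)
        \<longrightarrow> congruent_polygons P P')"
proof (intro conjI allI impI; elim conjE)
  fix P P' :: "(real ^ 2) list"
  assume len: "length P = n" "length P' = n" and simple: "simple_polygon P" "simple_polygon P'"
    and cyclic: "euclidean_cyclic P" "euclidean_cyclic P'"
    and sides: "\<forall>i<n. side_length P i = side_length P' i"
  have "dist (P' ! i) (P' ! j) / 2 = dist (P ! i) (P ! j) / 2" if "i < n" "j < n" for i j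
    by (rule chords_determined_by_sides[of n "\<lambda>i j. dist (P' ! i) (P' ! j) / 2" "\<lambda>i j. dist (P ! i) (P ! j) / 2"])
      (use euclidean_cyclic_polygon(1)[OF simple(1) cyclic(1)] euclidean_cyclic_polygon(1)[OF simple(2) cyclic(2)]
        sides len that in \<open>auto simp: side_length_nth\<close>)
  then show "congruent_polygons P P'"
    using euclidean_cyclic_polygon(2)[OF simple(1) cyclic(1)] euclidean_cyclic_polygon(2)[OF simple(2) cyclic(2)]
    by (intro euclid.congruent_polygons_if_dist_eq[OF len assms]) auto
next
  fix P P' :: "hyp_plane list"
  assume len: "length P = n" "length P' = n" and simple: "simple_polygon P" "simple_polygon P'"
    and cyclic: "hyperbolic_cyclic P" "hyperbolic_cyclic P'"
    and sides: "\<forall>i<n. side_length P i = side_length P' i"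
  have "sinh (dist (P' ! i) (P' ! j) / 2) = sinh (dist (P ! i) (P ! j) / 2)" if "i < n" "j < n" for i j
    by (rule chords_determined_by_sides[of n "\<lambda>i j. sinh (dist (P' ! i) (P' ! j) / 2)"
          "\<lambda>i j. sinh (dist (P ! i) (P ! j) / 2)"])
      (use hyperbolic_cyclic_polygon(1)[OF simple(1) cyclic(1)] hyperbolic_cyclic_polygon(1)[OF simple(2) cyclic(2)]
        sides len that in \<open>auto simp: side_length_nth\<close>)
  then show "congruent_polygons P P'"
    using hyperbolic_cyclic_polygon(2)[OF simple(1) cyclic(1)] hyperbolic_cyclic_polygon(2)[OF simple(2) cyclic(2)]
    by (intro hyp.congruent_polygons_if_dist_eq[OF len assms]) auto
qed

end
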